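(* Let $P\subset\mathbb{R}^3$ be a $2$-point homogeneous (convex, three-dimensional) polyhedron all of whose edges have the same length. Then $P$ is either the cuboctahedron or a regular polyhedron.
   Context: For a metric space $(M,d)$, $\operatorname{Isom}(M)$ is the group of isometries (distance-preserving bijections) of $M$ onto itself. $(M,d)$ is called $m$-point homogeneous, $m\in\mathbb{N}$, if for every $m$-tuples $(A_1,\dots,A_m)$ and $(B_1,\dots,B_m)$ of (not necessarily distinct) elements of $M$ with $d(A_i,A_j)=d(B_i,B_j)$ for all $i,j=1,\dots,m$, there is $f\in \operatorname{Isom}(M)$ with $f(A_i)=B_i$ for $i=1,\dots,m$. A convex polytope in $\mathbb{R}^n$ is called $m$-point homogeneous if its vertex set, with the metric induced by the Euclidean metric of $\mathbb{R}^n$, is $m$-point homogeneous. The regular polyhedra are the five Platonic solids: regular tetrahedron, cube, regular octahedron, regular dodecahedron, regular icosahedron. The cuboctahedron is (up to similarity) the convex hull of the midpoints of all edges of a cube. Polyhedra are identified up to similarity. *)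

theory Defs
  imports "HOL-Analysis.Analysis"
begin

text \<open>A metric space is rendered as a subset \<open>M\<close> of a type of class \<open>metric_space\<close> with the
  induced metric. Members of \<open>Isom M\<close> are total functions; only their values on \<open>M\<close> matter.\<close>

definition Isom :: "'a::metric_space set \<Rightarrow> ('a \<Rightarrow> 'a) set" where
  "Isom M = {f. bij_betw f M M \<and> (\<forall>x\<in>M. \<forall>y\<in>M. dist (f x) (f y) = dist x y)}"

definition point_homogeneous :: "nat \<Rightarrow> 'a::metric_space set \<Rightarrow> bool" where
  "point_homogeneous m M \<longleftrightarrow>
    (\<forall>A B :: nat \<Rightarrow> 'a.
       (\<forall>i\<in>{1..m}. A i \<in> M \<and> B i \<in> M) \<and>
       (\<forall>i\<in>{1..m}. \<forall>j\<in>{1..m}. dist (A i) (A j) = dist (B i) (B j)) \<longrightarrow>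
       (\<exists>f\<in>Isom M. \<forall>i\<in>{1..m}. f (A i) = B i))"

definition vertices :: "'a::euclidean_space set \<Rightarrow> 'a set" where
  "vertices P = {v. v extreme_point_of P}"

definition point_homogeneous_polytope :: "nat \<Rightarrow> 'a::euclidean_space set \<Rightarrow> bool" where
  "point_homogeneous_polytope m P \<longleftrightarrow> polytope P \<and> point_homogeneous m (vertices P)"

definition equal_edge_lengths :: "'a::euclidean_space set \<Rightarrow> bool" where
  "equal_edge_lengths P \<longleftrightarrow>
    (\<forall>a b c d. closed_segment a b edge_of P \<and> closed_segment c d edge_of P \<longrightarrow> dist a b = dist c d)"

definition similar :: "'a::metric_space set \<Rightarrow> 'a set \<Rightarrow> bool" where
  "similar S T \<longleftrightarrow>
    (\<exists>f r. 0 < r \<and> bij f \<and> (\<forall>x y. dist (f x) (f y) = r * dist x y) \<and> f ` S = T)"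

definition golden_ratio :: real where
  "golden_ratio = (1 + sqrt 5) / 2"

text \<open>Representatives of the similarity classes of the Platonic solids, all centred at the origin.
  The dodecahedron and the icosahedron are placed with three mutually orthogonal two-fold
  axes along the coordinate axes.\<close>

definition tetrahedron :: "(real^3) set" where
  "tetrahedron = convex hull
     {vector [1, 1, 1], vector [1, -1, -1], vector [-1, 1, -1], vector [-1, -1, 1]}"

definition cube :: "(real^3) set" where
  "cube = convex hull {vector [x, y, z] | x y z. x \<in> {-1, 1} \<and> y \<in> {-1, 1} \<and> z \<in> {-1, 1}}"

definition octahedron :: "(real^3) set" where
  "octahedron = convex hull
     (\<Union>s\<in>{-1, 1}. {vector [s, 0, 0], vector [0, s, 0], vector [0, 0, s]})"

definition dodecahedron :: "(real^3) set" where
  "dodecahedron = convex hull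
     ({vector [x, y, z] | x y z. x \<in> {-1, 1} \<and> y \<in> {-1, 1} \<and> z \<in> {-1, 1}} \<union>
      (\<Union>s\<in>{-1, 1}. \<Union>t\<in>{-1, 1}.
         {vector [0, s / golden_ratio, t * golden_ratio],
          vector [s / golden_ratio, t * golden_ratio, 0],
          vector [t * golden_ratio, 0, s / golden_ratio]}))"

definition icosahedron :: "(real^3) set" where
  "icosahedron = convex hull
     (\<Union>s\<in>{-1, 1}. \<Union>t\<in>{-1, 1}.
        {vector [0, s, t * golden_ratio],
         vector [s, t * golden_ratio, 0],
         vector [t * golden_ratio, 0, s]})"

definition cuboctahedron :: "(real^3) set" where
  "cuboctahedron = convex hull {midpoint a b | a b. closed_segment a b edge_of cube}"

definition regular_polyhedron :: "(real^3) set \<Rightarrow> bool" where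
  "regular_polyhedron P \<longleftrightarrow>
    similar P tetrahedron \<or> similar P cube \<or> similar P octahedron \<or>
    similar P dodecahedron \<or> similar P icosahedron"

end

theory Submission
  imports Defs
begin

text \<open>
  Let \<open>P\<close> be a polyhedron as in the theorem. Transitivity puts all vertices at the same distance
  from their centroid, so after a similarity they form a finite set \<open>V\<close> on the unit sphere, and
  isometries of \<open>V\<close> are restrictions of orthogonal maps. If \<open>t\<close> is the largest inner product of
  two distinct vertices, a pair \<open>p, q\<close> with \<open>p \<bullet> q = t\<close> is exposed by the functional \<open>p + q\<close>,
  hence spans an edge. As all edges have the same length, the edges are exactly the pairs with
  inner product \<open>t\<close>, and no two vertices are closer than the ends of an edge. From here on only
  \<open>V\<close> and \<open>t\<close> matter. Convexity enters through one fact (the simplex algorithm): a linear functional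
  that does not increase along any edge from \<open>v\<close> is maximal on \<open>V\<close> at \<open>v\<close>. It implies
  that the edge graph is connected and that the edges at \<open>v\<close> span the space.

  The neighbours of \<open>v\<close> lie on a circle, are permuted transitively by the stabiliser of \<open>v\<close>, and are
  at least an edge length apart; there are three, four or five of them. The decisive step is
  \<open>edge_reflection_V\<close>: for every edge the reflection that swaps its two ends is a symmetry of
  \<open>V\<close>. Homogeneity provides a symmetry that swaps the ends, which is either this reflection or a
  half-turn. If the degree is odd, or the neighbours of \<open>v\<close> form a square, the neighbours of
  \<open>v\<close> are symmetric about the plane through the edge, so both are symmetries; if they
  form a rectangle that is not a square, the half-turn would contradict convexity.

  Reflections in edges let one walk around the polygon that has two given edges at \<open>v\<close> as sides.
  Two points of \<open>V\<close> closer than an edge length coincide. Hence two edges at \<open>v\<close> either make an angle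
  of 60, 90 or 108 degrees, and the walk closes up after three, four or five steps, or they make
  an angle of at least 120 degrees (\<open>diagonal_ratio_cases\<close>). For degree three this leaves the tetrahedron, the cube and the
  dodecahedron, for degree four the octahedron, the cuboctahedron and the icosidodecahedron, and
  for degree five the icosahedron. The icosidodecahedron is not two-point homogeneous
  (\<open>no_icosidodecahedron\<close>): the four vertices orthogonal to \<open>v\<close> are not equivalent under the
  stabiliser of \<open>v\<close>.

  In each remaining case the inner products of \<open>v\<close> and two suitable neighbours are known, so these three
  points can be moved to three vertices of the model. Reflections then produce the other
  vertices of the model, and connectedness shows that there are no further ones.
\<close>

section \<open>Reflections and orthogonal maps\<close>

definition reflection :: "'a::real_inner \<Rightarrow> 'a \<Rightarrow> 'a" where
  "reflection e x = x - (2 * (x \<bullet> e) / (e \<bullet> e)) *\<^sub>R e"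

lemma reflection_reflection [simp]: "reflection e (reflection e x) = x"
  by (cases "e = 0") (simp_all add: reflection_def inner_diff_left)

lemma orthogonal_transformation_reflection: "orthogonal_transformation (reflection e)"
proof -
  have "linear (reflection e)"
    by (rule linearI) (simp_all add: reflection_def algebra_simps inner_add_left add_divide_distrib)
  moreover have "reflection e x \<bullet> reflection e y = x \<bullet> y" for x y
    by (cases "e = 0") (simp_all add: reflection_def inner_diff_left inner_diff_right inner_commute)
  ultimately show ?thesis
    by (simp add: orthogonal_transformation_def)
qed

lemma reflection_inner: "reflection e x \<bullet> reflection e y = x \<bullet> y"
  using orthogonal_transformation_reflection[of e] by (simp add: orthogonal_transformation_def)

lemma reflection_self_adjoint: "reflection e x \<bullet> y = x \<bullet> reflection e y"
  by (metis reflection_inner reflection_reflection)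

lemma reflection_orthogonal: "x \<bullet> e = 0 \<Longrightarrow> reflection e x = x"
  by (simp add: reflection_def)

lemma reflection_swap:
  assumes "x \<bullet> x = y \<bullet> y"
  shows "reflection (x - y) x = y"
proof (cases "x = y")
  case False
  then have "(x - y) \<bullet> (x - y) \<noteq> 0" by simp
  moreover have "2 * (x \<bullet> (x - y)) = (x - y) \<bullet> (x - y)"
    using assms by (simp add: inner_diff_left inner_diff_right inner_commute)
  ultimately show ?thesis by (simp add: reflection_def)
qed (simp add: reflection_def)

lemma orthogonal_transformation_inner:
  "orthogonal_transformation F \<Longrightarrow> F x \<bullet> F y = x \<bullet> y"
  by (simp add: orthogonal_transformation_def)

lemma orthogonal_transformation_diff:
  "orthogonal_transformation F \<Longrightarrow> F (x - y) = F x - F y"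
  by (simp add: orthogonal_transformation_linear linear_diff)

lemma orthogonal_transformation_scaleR:
  "orthogonal_transformation F \<Longrightarrow> F (c *\<^sub>R x) = c *\<^sub>R F x"
  by (simp add: orthogonal_transformation_linear linear_scale)

lemma reflection_scaleR: "c \<noteq> 0 \<Longrightarrow> reflection (c *\<^sub>R e) = reflection e"
  by (rule ext) (simp add: reflection_def field_simps)

lemma reflection_conjugate:
  assumes "orthogonal_transformation F"
  shows "F (reflection e x) = reflection (F e) (F x)"
  using assms
  by (simp add: reflection_def orthogonal_transformation_diff orthogonal_transformation_scaleR
      orthogonal_transformation_inner)

lemma span_UNIV_if_no_normal:
  fixes S :: "'a::euclidean_space set"
  assumes "\<And>G. (\<And>x. x \<in> S \<Longrightarrow> G \<bullet> x = 0) \<Longrightarrow> G = 0"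
  shows "span S = UNIV"
proof (rule ccontr)
  assume "span S \<noteq> UNIV"
  then have "dim S < DIM('a)"
    using dim_eq_full[of S] dim_subset_UNIV[of S] by linarith
  then obtain G where "G \<noteq> 0" "\<And>z. z \<in> span S \<Longrightarrow> orthogonal G z"
    using orthogonal_to_subspace_exists by blast
  then show False using assms[of G] by (auto simp: orthogonal_def span_base)
qed

text \<open>A linear combination of the \<open>b i\<close> has the same norm as the combination of the \<open>a i\<close> with the same
coefficients, because norms are determined by the Gram matrix. Hence sending one to the other is well
defined; no basis has to be selected, and \<open>a\<close> need not be injective.\<close>

lemma isometric_extension:
  fixes a b :: "'i \<Rightarrow> 'a::euclidean_space"
  assumes fin: "finite I" and sp: "span (a ` I) = UNIV"
    and gram: "\<And>i j. i \<in> I \<Longrightarrow> j \<in> I \<Longrightarrow> a i \<bullet> a j = b i \<bullet> b j"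
  shows "\<exists>F. orthogonal_transformation F \<and> (\<forall>i\<in>I. F (a i) = b i)"
proof -
  define A where "A c = (\<Sum>i\<in>I. c i *\<^sub>R a i)" for c
  define B where "B c = (\<Sum>i\<in>I. c i *\<^sub>R b i)" for c
  have ip: "B c \<bullet> B d = A c \<bullet> A d" for c d
    by (simp add: A_def B_def inner_sum_left inner_sum_right gram)
  have unit: "A (\<lambda>i. if i = j then 1 else 0) = a j" "B (\<lambda>i. if i = j then 1 else 0) = b j"
    if "j \<in> I" for j
    using fin that by (simp_all add: A_def B_def if_distrib[where f = "\<lambda>r. r *\<^sub>R _"] cong: if_cong)
  have sub: "subspace (range A)"
  proof (rule subspaceI)
    have "A (\<lambda>_. 0) = 0" by (simp add: A_def)
    then show "0 \<in> range A" by (metis rangeI)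
  next
    fix x y assume "x \<in> range A" "y \<in> range A"
    then obtain c d where "x = A c" "y = A d" by auto
    then have "x + y = A (\<lambda>i. c i + d i)" by (simp add: A_def scaleR_add_left sum.distrib)
    then show "x + y \<in> range A" by simp
  next
    fix r x assume "x \<in> range A"
    then obtain c where "x = A c" by auto
    then have "r *\<^sub>R x = A (\<lambda>i. r * c i)" by (simp add: A_def scaleR_sum_right)
    then show "r *\<^sub>R x \<in> range A" by simp
  qed
  have "a ` I \<subseteq> range A" using unit(1) by (metis image_subsetI rangeI)
  then have "range A = UNIV" using sp span_minimal[OF _ sub] by blast
  then obtain c where c: "\<And>x. A (c x) = x" by (metis surjD)
  define F where "F x = B (c x)" for x
  have Fip: "F x \<bullet> F y = x \<bullet> y" for x y by (simp add: F_def ip c)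
  have FB: "F (A d) = B d" for d
  proof -
    have "(F (A d) - B d) \<bullet> (F (A d) - B d) = (A (c (A d)) - A d) \<bullet> (A (c (A d)) - A d)"
      unfolding inner_diff_left inner_diff_right F_def ip ..
    then show ?thesis by (simp add: c)
  qed
  have "F (a j) = b j" if "j \<in> I" for j
    using FB unit[OF that] by metis
  moreover have "linear F"
  proof (rule linearI)
    fix x y
    have "norm (F (x + y) - (F x + F y)) ^ 2 = 0"
      by (simp add: power2_norm_eq_inner inner_diff_left inner_diff_right inner_add_left
          inner_add_right Fip)
    then show "F (x + y) = F x + F y" by simp
  next
    fix r x
    have "norm (F (r *\<^sub>R x) - r *\<^sub>R F x) ^ 2 = 0"
      by (simp add: power2_norm_eq_inner inner_diff_left inner_diff_right Fip)
    then show "F (r *\<^sub>R x) = r *\<^sub>R F x" by simp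
  qed
  ultimately show ?thesis using Fip by (auto simp: orthogonal_transformation_def)
qed

section \<open>Exposed edges of a finite set\<close>

text \<open>The pairs that span a one-dimensional exposed face of the convex hull. Stating this with a functional on
the finite set itself makes it stable under similarities.\<close>

definition exposed_pair :: "'a::real_inner set \<Rightarrow> 'a \<Rightarrow> 'a \<Rightarrow> bool" where
  "exposed_pair S p q \<longleftrightarrow> p \<in> S \<and> q \<in> S \<and> p \<noteq> q \<and>
     (\<exists>h c. h \<bullet> p = c \<and> h \<bullet> q = c \<and> (\<forall>x\<in>S - {p, q}. h \<bullet> x < c))"

lemma exposed_pair_edge_of:
  fixes S :: "'a::euclidean_space set"
  assumes fin: "finite S" and ex: "exposed_pair S p q"
  shows "closed_segment p q edge_of convex hull S"
proof -
  obtain h c where h: "p \<in> S" "q \<in> S" "p \<noteq> q" "h \<bullet> p = c" "h \<bullet> q = c"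
    "\<And>x. x \<in> S - {p, q} \<Longrightarrow> h \<bullet> x < c"
    using ex by (auto simp: exposed_pair_def)
  have 1: "affine hull {p, q} \<subseteq> {x. h \<bullet> x = c}"
    by (rule hull_minimal) (use h in \<open>auto intro: affine_hyperplane\<close>)
  have 2: "convex hull (S - {p, q}) \<subseteq> {x. h \<bullet> x < c}"
    by (rule hull_minimal) (use h in \<open>auto intro: convex_halfspace_lt\<close>)
  have "convex hull {p, q} face_of convex hull S"
  proof (rule face_of_convex_hulls)
    show "affine hull {p, q} \<inter> convex hull (S - {p, q}) = {}"
    proof (rule ccontr)
      assume "\<not> ?thesis"
      then obtain x where "x \<in> affine hull {p, q}" "x \<in> convex hull (S - {p, q})" by blast
      then have "h \<bullet> x = c" "h \<bullet> x < c" using 1 2 by blast+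
      then show False by simp
    qed
  qed (use h fin in auto)
  then show ?thesis
    using h by (simp add: edge_of_def segment_convex_hull aff_dim_convex_hull aff_dim_2)
qed

text \<open>The step of the simplex algorithm: from a vertex at which \<open>G\<close> is not maximal some edge leads upwards. The
hyperplane tangent to the sphere at \<open>v\<close> exposes \<open>v\<close>; projecting the other points from
\<open>v\<close> to a parallel hyperplane gives the vertex figure \<open>?Q\<close>. An extreme point of \<open>?Q\<close> at which \<open>G\<close> is
maximal is exposed, and the functional that exposes it, corrected by a multiple of \<open>v\<close>,
exposes an edge.\<close>

lemma improving_edge:
  fixes S :: "'a::euclidean_space set"
  assumes fin: "finite S" and unit: "\<And>x. x \<in> S \<Longrightarrow> x \<bullet> x = 1"
    and v: "v \<in> S" and z: "z \<in> S" "G \<bullet> v < G \<bullet> z"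
  shows "\<exists>u. exposed_pair S v u \<and> G \<bullet> v < G \<bullet> u"
proof -
  have lt1: "v \<bullet> x < 1" if "x \<in> S - {v}" for x
  proof -
    have "0 < (v - x) \<bullet> (v - x)" using that by auto
    also have "\<dots> = 2 - 2 * (v \<bullet> x)"
      using unit that v by (simp add: inner_diff_left inner_diff_right inner_commute)
    finally show ?thesis by simp
  qed
  define Y where "Y x = (1 / (1 - v \<bullet> x)) *\<^sub>R (x - v)" for x
  define T where "T = Y ` (S - {v})"
  have finT: "finite T" by (simp add: T_def fin)
  (* Y x is the inversion of x about v, up to a factor, so it determines x *)
  have Yx: "x = v + (2 / (Y x \<bullet> Y x)) *\<^sub>R Y x" if "x \<in> S - {v}" for x
  proof -
    define d where "d = 1 - v \<bullet> x"
    have "(x - v) \<bullet> (x - v) = 2 * d"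
      using unit that v by (simp add: d_def inner_diff_left inner_diff_right inner_commute)
    moreover have "0 < d" using lt1[OF that] by (simp add: d_def)
    moreover have "Y x = (1 / d) *\<^sub>R (x - v)" by (simp add: Y_def d_def)
    ultimately have *: "Y x \<bullet> Y x = 2 / d" "Y x = (1 / d) *\<^sub>R (x - v)" "d \<noteq> 0" by auto
    have "(2 / (Y x \<bullet> Y x)) *\<^sub>R Y x = d *\<^sub>R Y x" by (simp add: *(1))
    also have "\<dots> = x - v" by (simp add: *(2,3))
    finally show ?thesis by simp
  qed
  let ?Q = "convex hull T"
  have "z \<noteq> v" using z by auto
  then have zT: "Y z \<in> T" using z by (auto simp: T_def)
  have cQ: "compact ?Q" by (simp add: finT finite_imp_compact compact_convex_hull)
  have "?Q \<noteq> {}" using zT by auto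
  then obtain y0 where y0: "y0 \<in> ?Q" "\<And>y. y \<in> ?Q \<Longrightarrow> G \<bullet> y \<le> G \<bullet> y0"
    using continuous_attains_sup[OF cQ, of "\<lambda>y. G \<bullet> y"] continuous_on_inner[OF continuous_on_const continuous_on_id]
    by blast
  let ?F = "?Q \<inter> {y. G \<bullet> y = G \<bullet> y0}"
  have F: "?F face_of ?Q" by (rule face_of_Int_supporting_hyperplane_le) (use y0 in auto)
  have "compact ?F" using cQ by (intro compact_Int_closed closed_hyperplane)
  moreover have "convex ?F" by (intro convex_Int convex_convex_hull convex_hyperplane)
  moreover have "?F \<noteq> {}" using y0 by auto
  ultimately obtain y1 where y1: "y1 extreme_point_of ?F"
    using extreme_point_exists_convex by blast
  then have ext: "y1 extreme_point_of ?Q" and Gy1: "G \<bullet> y1 = G \<bullet> y0"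
    using extreme_point_of_face[OF F] by (auto simp: extreme_point_of_def)
  then have y1T: "y1 \<in> T" by (simp add: extreme_point_of_convex_hull)
  then obtain u where u: "u \<in> S - {v}" "y1 = Y u" by (auto simp: T_def)
  have "{y1} face_of ?Q" using ext by (simp add: face_of_singleton)
  then have "{y1} exposed_face_of ?Q"
    using exposed_face_of_polyhedron polyhedron_convex_hull finT by blast
  then obtain b d where bd: "?Q \<subseteq> {x. b \<bullet> x \<le> d}" "{y1} = ?Q \<inter> {x. b \<bullet> x = d}"
    by (auto simp: exposed_face_of_def)
  then have bd1: "b \<bullet> y1 = d" by auto
  have bd2: "b \<bullet> y < d" if "y \<in> T" "y \<noteq> y1" for y
  proof -
    have "y \<in> ?Q" using that by (simp add: hull_inc)
    then show ?thesis using bd that by fastforce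
  qed
  define h where "h = b + d *\<^sub>R v"
  have hx: "h \<bullet> x - h \<bullet> v = (1 - v \<bullet> x) * (b \<bullet> Y x - d)" if "x \<in> S - {v}" for x
  proof -
    have "(1 - v \<bullet> x) * (b \<bullet> Y x) = b \<bullet> x - b \<bullet> v"
      using lt1[OF that] by (simp add: Y_def inner_diff_right)
    then show ?thesis
      using unit[OF v] by (simp add: h_def inner_add_left right_diff_distrib algebra_simps)
  qed
  have "h \<bullet> u = h \<bullet> v" using hx[OF u(1)] u bd1 by simp
  moreover have "h \<bullet> x < h \<bullet> v" if "x \<in> S - {v, u}" for x
  proof -
    have "Y x \<noteq> y1" using Yx[of x] Yx[OF u(1)] u that by auto
    then have "b \<bullet> Y x < d" using bd2 that by (auto simp: T_def)
    then have "(1 - v \<bullet> x) * (b \<bullet> Y x - d) < 0"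
      using lt1[of x] that by (intro mult_pos_neg) auto
    then show ?thesis using hx[of x] that by simp
  qed
  ultimately have "exposed_pair S v u"
    using u v unfolding exposed_pair_def by (intro conjI exI[of _ h] exI[of _ "h \<bullet> v"]) auto
  moreover have "G \<bullet> v < G \<bullet> u"
  proof -
    have "0 < G \<bullet> Y z" using z lt1[of z] \<open>z \<noteq> v\<close> by (simp add: Y_def inner_diff_right)
    also have "\<dots> \<le> G \<bullet> Y u" using y0(2)[of "Y z"] zT Gy1 u by (simp add: hull_inc)
    finally show ?thesis
      using lt1[OF u(1)] by (simp add: Y_def inner_diff_right zero_less_divide_iff zero_less_mult_iff)
  qed
  ultimately show ?thesis by blast
qed

section \<open>Two counting arguments\<close>

lemma even_card_unique_partner:
  assumes "finite N" and sym: "\<And>x y. R x y \<Longrightarrow> R y x" and irr: "\<And>x. x \<in> N \<Longrightarrow> \<not> R x x"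
    and uniq: "\<And>x. x \<in> N \<Longrightarrow> \<exists>!y. y \<in> N \<and> R x y"
  shows "even (card N)"
  using assms(1) irr uniq
proof (induction "card N" arbitrary: N rule: less_induct)
  case less
  show ?case
  proof (cases "N = {}")
    case False
    then obtain x where x: "x \<in> N" by auto
    then obtain y where y: "y \<in> N" "R x y" using less.prems(3) by blast
    have xy: "x \<noteq> y" using less.prems(2) x y by auto
    let ?M = "N - {x, y}"
    have card: "card N = card ?M + 2"
    proof -
      have "card N = card ({x, y} \<union> ?M)" using x y by (intro arg_cong[where f = card]) auto
      also have "\<dots> = card {x, y} + card ?M" using less.prems(1) by (intro card_Un_disjoint) auto
      finally show ?thesis using xy by simp
    qed
    have "even (card ?M)"
    proof (rule less.hyps)
      show "card ?M < card N" using card by simp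
      fix z assume z: "z \<in> ?M"
      then show "\<not> R z z" using less.prems(2) by auto
      obtain w where w: "w \<in> N" "R z w" "\<And>w'. w' \<in> N \<Longrightarrow> R z w' \<Longrightarrow> w' = w"
        using less.prems(3)[of z] z by auto
      have "w \<noteq> x" "w \<noteq> y"
        using w z x y sym less.prems(3) by (metis Diff_iff insertCI)+
      then show "\<exists>!w. w \<in> ?M \<and> R z w" using w by blast
    qed (use less.prems in auto)
    then show ?thesis using card by simp
  qed simp
qed

text \<open>Measured from one of the points, the arguments of the others avoid the two sectors of 60 degrees next to it,
and each of the remaining four sectors contains at most one point.\<close>

lemma card_le_5_if_angles_gt_60:
  fixes Z :: "complex set"
  assumes fin: "finite Z" and unit: "\<And>z. z \<in> Z \<Longrightarrow> norm z = 1"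
    and sep: "\<And>z w. z \<in> Z \<Longrightarrow> w \<in> Z \<Longrightarrow> z \<noteq> w \<Longrightarrow> Re (z * cnj w) < 1 / 2"
  shows "card Z \<le> 5"
proof (cases "Z = {}")
  case False
  then obtain z0 where z0: "z0 \<in> Z" by auto
  define \<theta> where "\<theta> z = Arg2pi (z * cnj z0)" for z
  have norm1: "norm (z * cnj z0) = 1" if "z \<in> Z" for z
    using unit[OF that] unit[OF z0] by (simp add: norm_mult)
  have eq: "z * cnj z0 = cis (\<theta> z)" if "z \<in> Z" for z
    using norm1[OF that] Arg2pi_eq[of "z * cnj z0"] by (simp add: \<theta>_def cis_conv_exp)
  have rng: "0 \<le> \<theta> z" "\<theta> z < 2 * pi" for z
    by (simp_all add: \<theta>_def Arg2pi)
  have z01: "z0 * cnj z0 = 1"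
    using unit[OF z0] by (simp add: complex_norm_square[symmetric])
  have re: "Re (z * cnj w) = cos (\<theta> z - \<theta> w)" if "z \<in> Z" "w \<in> Z" for z w
  proof -
    have "(z * cnj z0) * cnj (w * cnj z0) = z * cnj w * (z0 * cnj z0)"
      by (simp only: complex_cnj_mult complex_cnj_cnj mult_ac)
    then have "z * cnj w = (z * cnj z0) * cnj (w * cnj z0)" by (simp only: z01 mult_1_right)
    also have "\<dots> = cis (\<theta> z - \<theta> w)" using eq that by (simp add: cis_cnj cis_mult)
    finally show ?thesis by simp
  qed
  have near: "1 / 2 \<le> cos d" if "\<bar>d\<bar> \<le> pi / 3" for d
  proof -
    have "cos (pi / 3) \<le> cos \<bar>d\<bar>" using that by (intro cos_monotone_0_pi_le) simp_all
    then show ?thesis by (simp only: cos_60 cos_abs_real)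
  qed
  have \<theta>0: "\<theta> z0 = 0"
    using z01 by (simp add: \<theta>_def Arg2pi_of_real[of 1, simplified])
  define s where "s z = \<lfloor>\<theta> z / (pi / 3)\<rfloor>" for z
  have "s ` (Z - {z0}) \<subseteq> {1..4}"
  proof
    fix i assume "i \<in> s ` (Z - {z0})"
    then obtain z where z: "z \<in> Z" "z \<noteq> z0" "i = s z" by auto
    have c: "cos (\<theta> z) < 1 / 2" using sep[of z z0] re[of z z0] z z0 \<theta>0 by simp
    have "\<theta> z > pi / 3"
    proof (rule ccontr)
      assume "\<not> ?thesis"
      then have "1 / 2 \<le> cos (\<theta> z)" using rng[of z] by (intro near) auto
      then show False using c by simp
    qed
    moreover have "\<theta> z < 5 * (pi / 3)"
    proof (rule ccontr)
      assume "\<not> ?thesis"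
      then have "\<bar>\<theta> z - 2 * pi\<bar> \<le> pi / 3" using rng[of z] by linarith
      moreover have "cos (\<theta> z - 2 * pi) = cos (\<theta> z)" by (simp add: cos_diff)
      ultimately show False using near[of "\<theta> z - 2 * pi"] c by simp
    qed
    ultimately have "1 < \<theta> z / (pi / 3)" "\<theta> z / (pi / 3) < 5"
      by (simp_all add: pos_less_divide_eq pos_divide_less_eq)
    then have "1 \<le> s z" "s z \<le> 4" unfolding s_def by linarith+
    then show "i \<in> {1..4}" using z by simp
  qed
  moreover have "inj_on s (Z - {z0})"
  proof (rule inj_onI, rule ccontr)
    fix z w assume zw: "z \<in> Z - {z0}" "w \<in> Z - {z0}" "s z = s w" "z \<noteq> w"
    have "\<bar>\<theta> z / (pi / 3) - \<theta> w / (pi / 3)\<bar> \<le> 1" using zw(3) unfolding s_def by linarith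
    moreover have "\<theta> z / (pi / 3) - \<theta> w / (pi / 3) = (\<theta> z - \<theta> w) / (pi / 3)"
      by (rule diff_divide_distrib[symmetric])
    ultimately have "\<bar>\<theta> z - \<theta> w\<bar> / (pi / 3) \<le> 1" 
      by (simp only: abs_divide abs_numeral abs_of_pos[OF pi_gt_zero])
    then have "\<bar>\<theta> z - \<theta> w\<bar> \<le> pi / 3" by (subst (asm) pos_divide_le_eq) simp_all
    then have "1 / 2 \<le> Re (z * cnj w)" using near re[of z w] zw by simp
    then show False using sep[of z w] zw by simp
  qed
  ultimately have "card (Z - {z0}) \<le> card {1..4::int}"
    by (metis card_image card_mono finite_atLeastAtMost_int)
  then show ?thesis using fin z0 by (simp add: card_Diff_singleton)
qed simp

section \<open>Vectors in space relative to a plane\<close>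

unbundle cross3_syntax

lemma orthogonal_to_frame:
  fixes v u d :: "real^3"
  assumes "v \<times> u \<noteq> 0" "d \<bullet> v = 0" "d \<bullet> u = 0" "d \<bullet> (v \<times> u) = 0"
  shows "d = 0"
proof -
  have "d \<times> (v \<times> u) = 0" using assms by (simp add: Lagrange)
  then have "(v \<times> u) \<times> d = (v \<times> u) \<times> 0"
    by (metis cross_skew cross_zero_right neg_0_equal_iff_equal)
  moreover have "(v \<times> u) \<bullet> d = (v \<times> u) \<bullet> 0" using assms(4) by (simp add: inner_commute)
  ultimately show ?thesis using cross_dot_cancel assms(1) by blast
qed

lemma parallel_to_cross:
  fixes v u m :: "real^3"
  assumes "v \<times> u \<noteq> 0" "m \<bullet> v = 0" "m \<bullet> u = 0"
  shows "m = (m \<bullet> (v \<times> u) / ((v \<times> u) \<bullet> (v \<times> u))) *\<^sub>R (v \<times> u)"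
proof -
  have "m - (m \<bullet> (v \<times> u) / ((v \<times> u) \<bullet> (v \<times> u))) *\<^sub>R (v \<times> u) = 0"
    using assms by (intro orthogonal_to_frame[of v u]) (simp_all add: inner_diff_left dot_cross_self)
  then show ?thesis by simp
qed

text \<open>The points with prescribed norm and prescribed inner products with \<open>v\<close> and \<open>u\<close> are the two points of
intersection of a sphere with a line orthogonal to the plane of \<open>v\<close> and \<open>u\<close>; they are mirror images.\<close>

lemma mirror_pair:
  fixes v u x y :: "real^3"
  assumes n: "v \<times> u \<noteq> 0" and "y \<bullet> v = x \<bullet> v" "y \<bullet> u = x \<bullet> u" "y \<bullet> y = x \<bullet> x"
  shows "y = x \<or> y = reflection (v \<times> u) x"
proof -
  define n where "n = v \<times> u"
  have nn: "n \<bullet> n \<noteq> 0" using n by (simp add: n_def)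
  obtain c where "y - x = c *\<^sub>R n"
    unfolding n_def using parallel_to_cross[OF n, of "y - x"] assms by (auto simp: inner_diff_left)
  then have y: "y = x + c *\<^sub>R n" by (simp add: algebra_simps)
  have "c * (2 * (x \<bullet> n) + c * (n \<bullet> n)) = 0"
    using assms(4) by (simp add: y inner_add_left inner_add_right inner_commute algebra_simps)
  then have "c = 0 \<or> c = - (2 * (x \<bullet> n) / (n \<bullet> n))"
    using nn by (simp only: mult_eq_0_iff minus_divide_left eq_divide_eq) argo
  then show ?thesis using y by (auto simp: reflection_def n_def)
qed

text \<open>The right-hand side is the half-turn about the axis through the midpoint of \<open>v\<close> and \<open>u\<close>. It swaps the
two points just as the reflection in their perpendicular bisector does, and differs from that reflection by
the reflection in their plane.\<close>

lemma half_turn_eq: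
  fixes v u x :: "real^3"
  assumes unit: "v \<bullet> v = 1" "u \<bullet> u = 1" and t: "v \<bullet> u = t" "\<bar>t\<bar> < 1"
  shows "reflection (v \<times> u) (reflection (v - u) x) = ((x \<bullet> v + x \<bullet> u) / (1 + t)) *\<^sub>R (v + u) - x"
    (is "?L = ?R")
proof -
  let ?n = "v \<times> u"
  have su: "reflection (v - u) v = u" using reflection_swap[of v u] unit by simp
  then have sv: "reflection (v - u) u = v" by (metis reflection_reflection)
  have perp: "?n \<bullet> (v - u) = 0" by (simp add: inner_diff_right dot_cross_self inner_commute)
  have "norm ?n ^ 2 = 1 - t\<^sup>2"
    using norm_cross[of v u] unit t by (simp add: power2_norm_eq_inner)
  moreover have "t\<^sup>2 < 1" using t(2) by (simp add: abs_square_less_1)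
  ultimately have n0: "?n \<noteq> 0" by auto
  have nv: "reflection ?n v = v" "reflection ?n u = u"
    by (simp_all add: reflection_orthogonal dot_cross_self)
  have Lv: "?L \<bullet> v = x \<bullet> u" and Lu: "?L \<bullet> u = x \<bullet> v"
    by (simp_all add: reflection_self_adjoint nv su sv)
  have "reflection ?n ?n = - ?n" using n0 by (simp add: reflection_def scaleR_2)
  moreover have "reflection (v - u) ?n = ?n" by (rule reflection_orthogonal) (rule perp)
  ultimately have Ln: "?L \<bullet> ?n = - (x \<bullet> ?n)"
    by (metis inner_minus_right reflection_self_adjoint)
  have t1: "1 + t \<noteq> 0" using t(2) by auto
  have R: "?R \<bullet> v = x \<bullet> u" "?R \<bullet> u = x \<bullet> v" "?R \<bullet> ?n = - (x \<bullet> ?n)"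
    using unit t t1
    by (simp_all add: inner_diff_left inner_add_left dot_cross_self inner_commute[of u v] add.commute)
  have "(?L - ?R) \<bullet> v = 0" "(?L - ?R) \<bullet> u = 0" "(?L - ?R) \<bullet> ?n = 0"
    unfolding inner_diff_left[of ?L ?R] Lv Lu Ln R by simp_all
  then have "?L - ?R = 0" by (rule orthogonal_to_frame[OF n0])
  then show ?thesis by simp
qed

section \<open>The golden ratio\<close>

lemma golden_ratio_square: "golden_ratio * golden_ratio = golden_ratio + 1"
  by (simp add: golden_ratio_def field_simps)

lemma golden_ratio_bounds: "3 / 2 < golden_ratio" "golden_ratio < 2"
proof -
  have "2 < sqrt 5" by (rule real_less_rsqrt) simp
  moreover have "sqrt 5 < 3" by (rule real_less_lsqrt) simp_all
  ultimately show "3 / 2 < golden_ratio" "golden_ratio < 2" by (simp_all add: golden_ratio_def)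
qed

lemma golden_ratio_unique:
  assumes "k * k = k + 1" "0 < k"
  shows "k = golden_ratio"
proof -
  have "(k - golden_ratio) * (k + golden_ratio - 1) = 0"
    using assms(1) golden_ratio_square by (simp add: algebra_simps)
  then show ?thesis using assms(2) golden_ratio_bounds by simp
qed

lemma inverse_golden_ratio: "x / golden_ratio = x * (golden_ratio - 1)"
proof -
  have "golden_ratio * (golden_ratio - 1) = 1" by (simp add: right_diff_distrib golden_ratio_square)
  then have "x = x * (golden_ratio - 1) * golden_ratio" by (metis mult.assoc mult.commute mult_1_right)
  moreover have "golden_ratio \<noteq> 0" using golden_ratio_bounds by simp
  ultimately show ?thesis by (metis nonzero_mult_div_cancel_right)
qed

lemma golden_ratio_square_left: "golden_ratio * (golden_ratio * z) = golden_ratio * z + z"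
  using golden_ratio_square by (metis distrib_right mult.assoc mult_1)

section \<open>Two-point homogeneous sets on the unit sphere\<close>

text \<open>The vertices of the polyhedron after normalisation. The edges are the pairs with inner product \<open>t\<close>;
\<open>local_max\<close> is what remains of the fact that these pairs are all the edges of the convex hull.\<close>

locale homogeneous_sphere_set =
  fixes V :: "(real^3) set" and t :: real
  assumes fin: "finite V" and unit: "x \<in> V \<Longrightarrow> x \<bullet> x = 1"
    and t_lt_1: "t < 1"
    and sep: "x \<in> V \<Longrightarrow> y \<in> V \<Longrightarrow> x \<noteq> y \<Longrightarrow> x \<bullet> y \<le> t"
    and homog: "\<lbrakk>x \<in> V; y \<in> V; x' \<in> V; y' \<in> V; x \<bullet> y = x' \<bullet> y'\<rbrakk>
      \<Longrightarrow> \<exists>F. orthogonal_transformation F \<and> F ` V = V \<and> F x = x' \<and> F y = y'"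
    and local_max: "\<lbrakk>v \<in> V; \<And>u. u \<in> V \<Longrightarrow> u \<bullet> v = t \<Longrightarrow> G \<bullet> u \<le> G \<bullet> v; x \<in> V\<rbrakk> \<Longrightarrow> G \<bullet> x \<le> G \<bullet> v"
    and full: "(\<And>x. x \<in> V \<Longrightarrow> G \<bullet> x = c) \<Longrightarrow> G = 0"
begin

definition N :: "real^3 \<Rightarrow> (real^3) set" where "N v = {u \<in> V. u \<bullet> v = t}"

lemma in_N: "u \<in> N v \<longleftrightarrow> u \<in> V \<and> u \<bullet> v = t"
  by (simp add: N_def)

lemma N_sym: "v \<in> V \<Longrightarrow> u \<in> N v \<Longrightarrow> v \<in> N u"
  by (simp add: N_def inner_commute)

lemma fin_N: "finite (N v)"
  using fin by (simp add: N_def)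

text \<open>Otherwise take a point \<open>z\<close> outside \<open>W\<close> and the point \<open>w\<close> of \<open>W\<close> nearest to it: the functional
\<open>z\<close> has a local maximum at \<open>w\<close>, but on the sphere its only maximum is \<open>z\<close>.\<close>

lemma connected:
  assumes "W \<subseteq> V" "W \<noteq> {}" and closed: "\<And>w. w \<in> W \<Longrightarrow> N w \<subseteq> W"
  shows "W = V"
proof (rule ccontr)
  assume "W \<noteq> V"
  then obtain z where z: "z \<in> V" "z \<notin> W" using assms by auto
  have "finite W" using assms fin finite_subset by blast
  then have fW: "finite ((\<bullet>) z ` W)" and "Max ((\<bullet>) z ` W) \<in> (\<bullet>) z ` W"
    using assms(2) by (auto intro!: Max_in)
  then obtain w where w: "w \<in> W" "Max ((\<bullet>) z ` W) = z \<bullet> w" by auto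
  have max: "z \<bullet> x \<le> z \<bullet> w" if "x \<in> W" for x
    using Max_ge[OF fW, of "z \<bullet> x"] that w(2) by simp
  have "z \<bullet> z \<le> z \<bullet> w"
    by (rule local_max) (use w z assms max closed[OF w(1)] in \<open>auto simp: N_def\<close>)
  moreover have "z \<bullet> w \<le> t" by (rule sep) (use w z assms in auto)
  ultimately show False using unit[OF z(1)] t_lt_1 by simp
qed

lemma N_image:
  assumes F: "orthogonal_transformation F" "F ` V = V"
  shows "F ` N v = N (F v)"
proof
  show "F ` N v \<subseteq> N (F v)" using F by (auto simp: in_N orthogonal_transformation_inner)
  show "N (F v) \<subseteq> F ` N v"
  proof
    fix y assume y: "y \<in> N (F v)"
    then obtain x where "x \<in> V" "y = F x" using F by (auto simp: in_N)
    then show "y \<in> F ` N v" using y F by (auto simp: in_N orthogonal_transformation_inner)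
  qed
qed

lemma stabilizer_transitive:
  assumes "v \<in> V" "u \<in> N v" "w \<in> N v"
  shows "\<exists>F. orthogonal_transformation F \<and> F ` N v = N v \<and> F v = v \<and> F u = w"
proof -
  obtain F where "orthogonal_transformation F" "F ` V = V" "F v = v" "F u = w"
    using homog[of v u v w] assms by (auto simp: in_N inner_commute)
  then show ?thesis using N_image[of F v] by metis
qed

lemma card_N_eq:
  assumes "v \<in> V" "w \<in> V"
  shows "card (N v) = card (N w)"
proof -
  obtain F where F: "orthogonal_transformation F" "F ` V = V" "F v = w"
    using homog[of v v w w] assms unit by auto
  then have "N w = F ` N v" using N_image by metis
  then show ?thesis
    using F by (metis card_image inj_on_subset orthogonal_transformation_inj subset_UNIV)
qed

text \<open>Both \<open>G\<close> and \<open>- G\<close> have a local, hence global, maximum at \<open>v\<close>, so \<open>V\<close> would lie in a plane.\<close>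

lemma edges_span:
  assumes "v \<in> V" and "\<And>u. u \<in> N v \<Longrightarrow> G \<bullet> u = G \<bullet> v"
  shows "G = 0"
proof (rule full)
  fix x assume "x \<in> V"
  then have "G \<bullet> x \<le> G \<bullet> v" "(- G) \<bullet> x \<le> (- G) \<bullet> v"
    using local_max[of v G x] local_max[of v "- G" x] assms by (auto simp: in_N)
  then show "G \<bullet> x = G \<bullet> v" by simp
qed

text \<open>Let \<open>w\<close> be the component of the sum orthogonal to \<open>v\<close>. The stabiliser of \<open>v\<close> fixes
\<open>w\<close> and permutes the neighbours transitively, so they all have the same inner product with
\<open>w\<close>. Then a combination of \<open>v\<close> and \<open>w\<close> is constant on \<open>v\<close> and its neighbours,
which forces \<open>w = 0\<close>.\<close>

lemma sum_N:
  assumes v: "v \<in> V"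
  shows "\<Sum>(N v) = (card (N v) * t) *\<^sub>R v"
proof -
  let ?k = "real (card (N v))"
  define w where "w = \<Sum>(N v) - (?k * t) *\<^sub>R v"
  have wv: "w \<bullet> v = 0"
    using unit[OF v] by (simp add: w_def inner_diff_left inner_sum_left in_N)
  have const: "u \<bullet> w = u' \<bullet> w" if u: "u \<in> N v" "u' \<in> N v" for u u'
  proof -
    obtain F where F: "orthogonal_transformation F" "F ` N v = N v" "F v = v" "F u = u'"
      using stabilizer_transitive[OF v u] by auto
    have "F (\<Sum>(N v)) = (\<Sum>x\<in>N v. F x)"
      using F(1) by (simp add: linear_sum orthogonal_transformation_linear)
    also have "\<dots> = \<Sum>(F ` N v)"
      using orthogonal_transformation_inj[OF F(1)]
      by (simp add: sum.reindex inj_on_subset[of F UNIV])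
    finally have "F w = w"
      using F by (simp add: w_def orthogonal_transformation_diff orthogonal_transformation_scaleR)
    then show ?thesis using orthogonal_transformation_inner[OF F(1), of u w] F(4) by simp
  qed
  have kq: "?k * (u \<bullet> w) = w \<bullet> w" if u: "u \<in> N v" for u
  proof -
    have "(\<Sum>x\<in>N v. x \<bullet> w) = (\<Sum>x\<in>N v. u \<bullet> w)"
      by (rule sum.cong[OF refl]) (rule const[OF _ u])
    then have "?k * (u \<bullet> w) = (\<Sum>x\<in>N v. x \<bullet> w)" by simp
    also have "\<dots> = \<Sum>(N v) \<bullet> w" by (simp add: inner_sum_left)
    also have "\<dots> = w \<bullet> w" using wv by (simp add: w_def inner_diff_left inner_diff_right inner_commute)
    finally show ?thesis .
  qed
  let ?G = "(w \<bullet> w) *\<^sub>R v + (?k * (1 - t)) *\<^sub>R w"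
  have "?G = 0"
  proof (rule edges_span[OF v])
    fix u assume u: "u \<in> N v"
    have "?G \<bullet> u = (w \<bullet> w) * t + (1 - t) * (?k * (u \<bullet> w))"
      using u by (simp add: inner_add_left in_N inner_commute algebra_simps)
    also have "\<dots> = w \<bullet> w" by (simp only: kq[OF u]) (simp add: algebra_simps)
    also have "\<dots> = ?G \<bullet> v" using unit[OF v] wv by (simp add: inner_add_left)
    finally show "?G \<bullet> u = ?G \<bullet> v" .
  qed
  then have "?G \<bullet> v = 0" by simp
  then have "w = 0" using unit[OF v] wv by (simp add: inner_add_left)
  then show ?thesis by (simp add: w_def)
qed

section \<open>The number of neighbours\<close>

lemma card_N_ge_3:
  assumes v: "v \<in> V"
  shows "3 \<le> card (N v)"
proof (rule ccontr)
  assume "\<not> ?thesis"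
  then have "card ((\<lambda>u. u - v) ` N v) \<le> 2" using card_image_le[OF fin_N, of "\<lambda>u. u - v" v] by linarith
  then have "dim ((\<lambda>u. u - v) ` N v) \<le> 2"
    using dim_le_card'[of "(\<lambda>u. u - v) ` N v"] fin_N by (meson finite_imageI le_trans)
  then have "dim ((\<lambda>u. u - v) ` N v) < DIM(real^3)" by simp
  then obtain G where "G \<noteq> 0" "\<And>y. y \<in> span ((\<lambda>u. u - v) ` N v) \<Longrightarrow> orthogonal G y"
    using orthogonal_to_subspace_exists by blast
  moreover have "G \<bullet> u = G \<bullet> v" if "u \<in> N v" for u
    using calculation(2)[of "u - v"] that by (auto simp: orthogonal_def inner_diff_right intro: span_base)
  ultimately show False using edges_span[OF v] by blast
qed

lemma ex_V: "\<exists>v. v \<in> V"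
proof (rule ccontr)
  assume "\<not> ?thesis"
  then have "(axis 1 1 :: real^3) = 0" by (intro full) auto
  then show False by (simp add: axis_eq_0_iff)
qed

lemma t_gt: "-1 < t"
proof -
  obtain v where v: "v \<in> V" using ex_V by auto
  have "\<not> N v \<subseteq> {- v}" using card_mono[of "{- v}" "N v"] card_N_ge_3[OF v] by auto
  then obtain u where u: "u \<in> N v" "u \<noteq> - v" by auto
  then have "0 < (u + v) \<bullet> (u + v)" by (simp add: eq_neg_iff_add_eq_0)
  also have "\<dots> = 2 + 2 * t"
    using u v unit by (simp add: in_N inner_add_left inner_add_right inner_commute)
  finally show ?thesis by simp
qed

lemma abs_t: "\<bar>t\<bar> < 1"
  using t_gt t_lt_1 by auto

lemma t_sq: "t\<^sup>2 < 1"
  using abs_t by (simp add: abs_square_less_1)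

lemma cross_N_nonzero:
  assumes "v \<in> V" "u \<in> N v"
  shows "v \<times> u \<noteq> 0"
proof -
  have "norm (v \<times> u) ^ 2 = 1 - t\<^sup>2"
    using norm_cross[of v u] assms unit by (simp add: in_N power2_norm_eq_inner inner_commute)
  then show ?thesis using t_sq by auto
qed

text \<open>Seen from the axis through \<open>v\<close>, two neighbours of \<open>v\<close> enclose an angle whose cosine is at most
\<open>t / (1 + t) < 1 / 2\<close>, as they are at least an edge length apart.\<close>

lemma card_N_le_5:
  assumes v: "v \<in> V"
  shows "card (N v) \<le> 5"
proof -
  have "norm v = norm (axis 3 1 :: real^3)" using unit[OF v] by (simp add: norm_eq_1)
  then obtain f where f: "orthogonal_transformation f" "f v = (axis 3 1 :: real^3)"
    by (rule orthogonal_transformation_exists)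
  have f3: "f u $ 3 = t" if "u \<in> N v" for u
  proof -
    have "f u \<bullet> f v = t"
      using orthogonal_transformation_inner[OF f(1), of u v] that by (simp only: in_N)
    then show ?thesis by (simp add: f inner_axis)
  qed
  define \<rho> where "\<rho> = sqrt (1 - t\<^sup>2)"
  have \<rho>: "0 < \<rho>" "\<rho> * \<rho> = 1 - t\<^sup>2" using t_sq by (simp_all add: \<rho>_def)
  define z where "z u = Complex (f u $ 1 / \<rho>) (f u $ 2 / \<rho>)" for u
  have Re: "Re (z u * cnj (z w)) = (u \<bullet> w - t\<^sup>2) / (1 - t\<^sup>2)" if "u \<in> N v" "w \<in> N v" for u w
  proof -
    have "u \<bullet> w = f u $ 1 * f w $ 1 + f u $ 2 * f w $ 2 + t\<^sup>2"
      using f3[OF that(1)] f3[OF that(2)] orthogonal_transformation_inner[OF f(1), of u w]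
      by (simp add: inner_vec_def sum_3 power2_eq_square)
    then show ?thesis by (simp add: z_def add_divide_distrib \<rho>(2)[symmetric])
  qed
  have bound: "Re (z u * cnj (z w)) < 1 / 2" if "u \<in> N v" "w \<in> N v" "u \<noteq> w" for u w
  proof -
    have "u \<bullet> w \<le> t" using that sep by (simp add: in_N)
    moreover have "0 < (1 - t) * (1 - t)" using t_lt_1 by simp
    ultimately have "2 * (u \<bullet> w - t\<^sup>2) < 1 - t\<^sup>2" by (simp add: power2_eq_square algebra_simps)
    then show ?thesis using Re[OF that(1,2)] t_sq by (simp add: pos_divide_less_eq)
  qed
  have n1: "Re (z u * cnj (z u)) = 1" if "u \<in> N v" for u
    using Re[OF that that] that unit t_sq by (simp add: in_N)
  have "inj_on z (N v)"
  proof (rule inj_onI, rule ccontr)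
    fix u w assume uw: "u \<in> N v" "w \<in> N v" "z u = z w" "u \<noteq> w"
    then have "Re (z u * cnj (z u)) < 1 / 2" using bound[of u w] by simp
    then show False using n1[OF uw(1)] by simp
  qed
  moreover have "card (z ` N v) \<le> 5"
  proof (rule card_le_5_if_angles_gt_60)
    show "finite (z ` N v)" using fin_N by simp
    fix a assume "a \<in> z ` N v"
    then obtain u where "u \<in> N v" "a = z u" by auto
    then have "(norm a)\<^sup>2 = 1\<^sup>2" using n1[of u]
      by (simp only: complex_norm_square[symmetric] power_one Re_complex_of_real)
    then show "norm a = 1" by (rule power2_eq_imp_eq) simp_all
  qed (use bound in auto)
  ultimately show ?thesis by (simp add: card_image)
qed

text \<open>If the mirror image of \<open>w\<close> about the plane through \<open>v\<close> and \<open>u\<close> is missing, \<open>w\<close> is the only neighbour with its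
inner product with \<open>u\<close>. By transitivity every neighbour then has exactly one partner with that inner
product, so the neighbours come in pairs.\<close>

lemma N_mirror_odd:
  assumes v: "v \<in> V" and odd: "odd (card (N v))" and u: "u \<in> N v" and w: "w \<in> N v"
  shows "reflection (v \<times> u) w \<in> N v"
proof (rule ccontr)
  assume out: "reflection (v \<times> u) w \<notin> N v"
  have "reflection (v \<times> u) u = u" by (simp add: reflection_orthogonal dot_cross_self)
  then have wu: "w \<noteq> u" using out u by metis
  have only: "c = w" if c: "c \<in> N v" "u \<bullet> c = u \<bullet> w" for c
    using mirror_pair[OF cross_N_nonzero[OF v u], of c w] c w out unit
    by (auto simp: in_N inner_commute)
  have "even (card (N v))"
  proof (rule even_card_unique_partner[OF fin_N, where R = "\<lambda>a b. a \<bullet> b = u \<bullet> w"])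
    show "\<not> a \<bullet> a = u \<bullet> w" if "a \<in> N v" for a
      using that unit sep[of u w] wu u w t_lt_1 by (auto simp: in_N)
    show "\<exists>!b. b \<in> N v \<and> a \<bullet> b = u \<bullet> w" if a: "a \<in> N v" for a
    proof -
      obtain F where F: "orthogonal_transformation F" "F ` N v = N v" "F v = v" "F u = a"
        using stabilizer_transitive[OF v u a] by auto
      show ?thesis
      proof (rule ex1I[of _ "F w"])
        show "F w \<in> N v \<and> a \<bullet> F w = u \<bullet> w"
          using F w orthogonal_transformation_inner[OF F(1), of u w] by auto
        fix b assume b: "b \<in> N v \<and> a \<bullet> b = u \<bullet> w"
        then obtain c where c: "c \<in> N v" "b = F c" using F(2) by (metis imageE)
        then have "u \<bullet> c = u \<bullet> w"
          using b F orthogonal_transformation_inner[OF F(1), of u c] by simp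
        then show "b = F w" using only[OF c(1)] c(2) by simp
      qed
    qed
  qed (simp add: inner_commute)
  then show False using odd by simp
qed

text \<open>The radius vectors of the four neighbours, measured from the centre of their circle, add up to zero. If the sum
\<open>m\<close> of two of them is not zero, these two and the negatives of the other two have the same inner product with
\<open>m\<close>. A circle has only two such points, so the four vectors form two pairs of opposite vectors.\<close>

lemma N_antipode:
  assumes v: "v \<in> V" and four: "card (N v) = 4" and u: "u \<in> N v"
  shows "(2 * t) *\<^sub>R v - u \<in> N v"
proof -
  have "card (N v - {u}) = 3" using four u by (simp add: card_Diff_singleton fin_N)
  then obtain b c d where bcd: "N v - {u} = {b, c, d}" "b \<noteq> c" "b \<noteq> d" "c \<noteq> d"
    by (auto simp: card_3_iff)
  then have Nv: "N v = {u, b, c, d}" and ub: "u \<noteq> b" "u \<noteq> c" "u \<noteq> d" using u by auto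
  have sum: "u + b + c + d = (4 * t) *\<^sub>R v"
    using sum_N[OF v] four bcd ub by (simp add: Nv add.assoc)
  have ip: "u \<bullet> v = t" "b \<bullet> v = t" "c \<bullet> v = t" "d \<bullet> v = t"
    and un: "u \<bullet> u = 1" "b \<bullet> b = 1" "c \<bullet> c = 1" "d \<bullet> d = 1" "v \<bullet> v = 1"
    using Nv v unit by (auto simp: N_def)
  define m where "m = u + b - (2 * t) *\<^sub>R v"
  define c' where "c' = (2 * t) *\<^sub>R v - c"
  have dc: "c + d = (2 * t) *\<^sub>R v - m"
  proof -
    have "c + d = (u + b + c + d) - (u + b)" by simp
    also have "\<dots> = ((2 * t) *\<^sub>R v + (2 * t) *\<^sub>R v) - (u + b)"
      unfolding sum scaleR_left_distrib[symmetric] by simp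
    finally show ?thesis by (simp add: m_def)
  qed
  show ?thesis
  proof (cases "m = 0")
    case True
    then have "b = (2 * t) *\<^sub>R v - u" by (simp add: m_def algebra_simps)
    then show ?thesis using Nv by auto
  next
    case False
    have vm: "v \<bullet> m = 0" using ip un by (simp add: m_def inner_add_right inner_diff_right inner_commute)
    have "norm (v \<times> m) ^ 2 = (norm m)\<^sup>2"
      using norm_cross[of v m] un vm by (simp add: power2_norm_eq_inner)
    then have vm0: "v \<times> m \<noteq> 0" using False by auto
    have mu: "u \<bullet> m = (m \<bullet> m) / 2" "b \<bullet> m = (m \<bullet> m) / 2"
      using ip un by (simp_all add: m_def inner_add_right inner_diff_right inner_add_left
          inner_diff_left inner_commute algebra_simps)
    have "d = (2 * t) *\<^sub>R v - m - c" using dc by (simp add: algebra_simps)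
    then have "((2 * t) *\<^sub>R v - m - c) \<bullet> ((2 * t) *\<^sub>R v - m - c) = 1" using un by simp
    then have "m \<bullet> m + 2 * (c \<bullet> m) = 0"
      using ip un vm by (simp add: inner_diff_right inner_diff_left inner_commute algebra_simps)
    then have mc: "c' \<bullet> m = (m \<bullet> m) / 2"
      using vm by (simp add: c'_def inner_diff_left)
    have c': "c' \<bullet> v = t" "c' \<bullet> c' = 1"
      using ip un by (simp_all add: c'_def inner_diff_left inner_diff_right inner_commute algebra_simps)
    have "b = u \<or> b = reflection (v \<times> m) u" by (rule mirror_pair[OF vm0]) (use ip un mu in auto)
    moreover have "c' = u \<or> c' = reflection (v \<times> m) u"
      by (rule mirror_pair[OF vm0]) (use ip un mu mc c' in auto)
    ultimately have "c' = u \<or> c' = b" using ub by auto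
    then show ?thesis
    proof
      assume "c' = u"
      then have "c = (2 * t) *\<^sub>R v - u" by (simp add: c'_def algebra_simps)
      then show ?thesis using Nv by auto
    next
      assume "c' = b"
      then have "d = (2 * t) *\<^sub>R v - u"
        using dc by (simp add: c'_def m_def algebra_simps)
      then show ?thesis using Nv by auto
    qed
  qed
qed

text \<open>Under these hypotheses \<open>u\<close> and \<open>w\<close> are adjacent corners of the rectangle of neighbours.\<close>

lemma N_four:
  assumes v: "v \<in> V" and four: "card (N v) = 4" and uw: "u \<in> N v" "w \<in> N v"
    "w \<noteq> u" "w \<noteq> (2 * t) *\<^sub>R v - u"
  shows "N v = {u, w, (2 * t) *\<^sub>R v - u, (2 * t) *\<^sub>R v - w}"
proof -
  have neq: "x \<noteq> (2 * t) *\<^sub>R v - x" if x: "x \<in> N v" for x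
  proof
    assume "x = (2 * t) *\<^sub>R v - x"
    then have "x \<bullet> x = ((2 * t) *\<^sub>R v - x) \<bullet> x" by (rule arg_cong)
    then have "1 = t\<^sup>2" using x unit v
      by (simp add: in_N inner_diff_left inner_diff_right inner_commute power2_eq_square)
    then show False using t_sq by simp
  qed
  have "w \<noteq> (2 * t) *\<^sub>R v - u \<longleftrightarrow> u \<noteq> (2 * t) *\<^sub>R v - w" by (auto simp: algebra_simps)
  then have "card {u, w, (2 * t) *\<^sub>R v - u, (2 * t) *\<^sub>R v - w} = 4"
    using neq[of u] neq[of w] uw by (auto simp: card_insert_if)
  moreover have "{u, w, (2 * t) *\<^sub>R v - u, (2 * t) *\<^sub>R v - w} \<subseteq> N v"
    using N_antipode[OF v four] uw by auto
  ultimately show ?thesis using card_subset_eq[OF fin_N] four by metis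
qed

section \<open>Reflections in edges are symmetries\<close>

text \<open>Let \<open>x\<close> be the corner of the rectangle of neighbours next to \<open>u\<close> along a short side and \<open>q\<close>
the one along a long side. The plane through \<open>v\<close>, \<open>u\<close>, \<open>q\<close> supports \<open>V\<close>, but the half-turn that swaps
\<open>v\<close> and \<open>u\<close> carries \<open>x\<close> beyond it: the angle at the edge between the facet and the plane through the edge and the
centre is larger on the side of \<open>x\<close> than on the side of \<open>q\<close>.\<close>

lemma rectangle_half_turn_impossible:
  assumes v: "v \<in> V" and four: "card (N v) = 4" and u: "u \<in> N v" and x: "x \<in> N v" "x \<noteq> u"
    and s: "t\<^sup>2 < x \<bullet> u"
    and H: "((x \<bullet> v + x \<bullet> u) / (1 + t)) *\<^sub>R (v + u) - x \<in> V"
  shows False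
proof -
  define q where "q = (2 * t) *\<^sub>R v - x"
  have vv: "v \<bullet> v = 1" and uv: "v \<bullet> u = t" using unit v u by (auto simp: in_N inner_commute)
  have "x \<noteq> (2 * t) *\<^sub>R v - u"
  proof
    assume "x = (2 * t) *\<^sub>R v - u"
    then have "x \<bullet> u = 2 * t\<^sup>2 - 1"
      using uv unit[of u] u by (simp add: inner_diff_left power2_eq_square in_N)
    then show False using s t_sq by simp
  qed
  then have Nv: "N v = {u, x, (2 * t) *\<^sub>R v - u, q}"
    using N_four[OF v four u x] by (simp add: q_def)
  define D where "D = v \<bullet> (u \<times> q)"
  have D1: "q \<bullet> (v \<times> u) = D" "u \<bullet> (q \<times> v) = D"
    unfolding D_def by (metis cross_triple inner_commute)+
  have "D \<noteq> 0"
  proof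
    assume "D = 0"
    then have "(v \<times> u) \<bullet> q = 0" using D1 by (simp add: inner_commute)
    then have "(v \<times> u) \<bullet> y = (v \<times> u) \<bullet> v" if "y \<in> N v" for y
      using that Nv by (auto simp: q_def inner_diff_right dot_cross_self)
    then have "v \<times> u = 0" by (rule edges_span[OF v])
    then show False using cross_N_nonzero[OF v u] by simp
  qed
  define G where "G = (1 / D) *\<^sub>R (u \<times> q + q \<times> v + v \<times> u)"
  have G: "G \<bullet> v = 1" "G \<bullet> u = 1" "G \<bullet> q = 1"
    using D1 \<open>D \<noteq> 0\<close>
    by (simp_all add: G_def inner_add_left inner_commute[of _ v] inner_commute[of _ u]
        inner_commute[of _ q] dot_cross_self inner_add_right D_def[symmetric])
  have Gx: "G \<bullet> x = 2 * t - 1" using G by (simp add: q_def inner_diff_right)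
  have "G \<bullet> (((x \<bullet> v + x \<bullet> u) / (1 + t)) *\<^sub>R (v + u) - x) \<le> G \<bullet> v"
  proof (rule local_max[OF v _ H])
    fix y assume "y \<in> V" "y \<bullet> v = t"
    then have "y \<in> N v" by (simp add: in_N)
    then show "G \<bullet> y \<le> G \<bullet> v"
      using G Gx t_lt_1 Nv by (auto simp: inner_diff_right)
  qed
  then have "((t + x \<bullet> u) / (1 + t)) * 2 \<le> 2 * t"
    using G Gx x by (simp add: inner_diff_right inner_add_right in_N)
  then have "t + x \<bullet> u \<le> t * (1 + t)" using t_gt by (simp add: pos_divide_le_eq)
  then show False using s by (simp add: power2_eq_square algebra_simps)
qed

lemma edge_reflection_swap:
  assumes "v \<in> V" "u \<in> N v"
  shows "reflection (v - u) v = u" "reflection (v - u) u = v"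
proof -
  show "reflection (v - u) v = u" using reflection_swap[of v u] assms unit by (simp add: in_N)
  then show "reflection (v - u) u = v" by (metis reflection_reflection)
qed

text \<open>A symmetry \<open>F\<close> that swaps \<open>v\<close> and \<open>u\<close> agrees at each neighbour of \<open>v\<close> with the reflection \<open>?\<sigma>\<close> or
with the half-turn, which is \<open>?\<sigma>\<close> followed by the reflection \<open>?\<tau>\<close> in the plane of \<open>v\<close> and \<open>u\<close>. In
the second case \<open>?\<tau>\<close> preserves the neighbours of \<open>v\<close>, unless these form a rectangle that is not
a square.\<close>

lemma edge_reflection_N_subset:
  assumes v: "v \<in> V" and u: "u \<in> N v" and w: "w \<in> N v"
  shows "reflection (v - u) w \<in> N u"
proof -
  define n where "n = v \<times> u"
  let ?\<sigma> = "reflection (v - u)" and ?\<tau> = "reflection n"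
  have uV: "u \<in> V" and uv: "u \<bullet> v = t" using u by (auto simp: in_N)
  note sw = edge_reflection_swap[OF v u]
  have tau: "?\<tau> v = v" "?\<tau> u = u" by (simp_all add: n_def reflection_orthogonal dot_cross_self)
  have "?\<sigma> n = n"
    by (rule reflection_orthogonal) (simp add: n_def inner_diff_right dot_cross_self)
  then have comm: "?\<sigma> (?\<tau> x) = ?\<tau> (?\<sigma> x)" for x
    using reflection_conjugate[OF orthogonal_transformation_reflection, of "v - u" n x] by simp
  obtain F where F: "orthogonal_transformation F" "F ` V = V" "F v = u" "F u = v"
    using homog[of v u u v] v uV by (auto simp: inner_commute)
  have FN: "F x \<in> N u" if "x \<in> N v" for x using N_image[OF F(1,2), of v] that F(3) by auto
  have F2: "F x = ?\<sigma> x \<or> F x = ?\<tau> (?\<sigma> x)" if x: "x \<in> N v" for x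
    unfolding n_def
  proof (rule mirror_pair[OF cross_N_nonzero[OF v u]])
    show "F x \<bullet> v = ?\<sigma> x \<bullet> v"
      using orthogonal_transformation_inner[OF F(1), of x u] by (simp add: F reflection_self_adjoint sw)
    show "F x \<bullet> u = ?\<sigma> x \<bullet> u"
      using orthogonal_transformation_inner[OF F(1), of x v] by (simp add: F reflection_self_adjoint sw)
    show "F x \<bullet> F x = ?\<sigma> x \<bullet> ?\<sigma> x"
      by (simp add: reflection_inner orthogonal_transformation_inner[OF F(1)])
  qed
  consider "F w = ?\<sigma> w" | "F w = ?\<tau> (?\<sigma> w)" "?\<tau> w \<in> N v" | "F w = ?\<tau> (?\<sigma> w)" "?\<tau> w \<notin> N v"
    using F2[OF w] by auto
  then show ?thesis
  proof cases
    case 1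
    then show ?thesis using FN[OF w] by simp
  next
    case 2
    have "F (?\<tau> w) = ?\<tau> (?\<sigma> w) \<or> F (?\<tau> w) = ?\<sigma> w"
      using F2[OF 2(2)] by (simp add: comm)
    then show ?thesis
    proof
      assume "F (?\<tau> w) = ?\<tau> (?\<sigma> w)"
      then have "?\<tau> w = w"
        using 2(1) injD[OF orthogonal_transformation_inj[OF F(1)], of "?\<tau> w" w] by simp
      then show ?thesis using FN[OF w] 2(1) by (simp add: comm[symmetric])
    next
      assume "F (?\<tau> w) = ?\<sigma> w"
      then show ?thesis using FN[OF 2(2)] by simp
    qed
  next
    case 3
    have "even (card (N v))" using N_mirror_odd[OF v _ u w] 3(2) by (auto simp: n_def)
    moreover have "card (N v) \<in> {3, 4, 5}" using card_N_ge_3[OF v] card_N_le_5[OF v] by auto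
    ultimately have four: "card (N v) = 4" by auto
    define w' where "w' = (2 * t) *\<^sub>R v - w"
    have w': "w' \<in> N v" unfolding w'_def by (rule N_antipode[OF v four w])
    have vu: "v \<bullet> v = 1" "u \<bullet> u = 1" "v \<bullet> u = t" using unit v uV uv by (auto simp: inner_commute)
    have turn: "?\<tau> (?\<sigma> x) = ((x \<bullet> v + x \<bullet> u) / (1 + t)) *\<^sub>R (v + u) - x" for x
      unfolding n_def by (rule half_turn_eq) (use vu abs_t in auto)
    have "F w' = ?\<tau> (?\<sigma> w')"
      by (simp add: w'_def orthogonal_transformation_diff orthogonal_transformation_scaleR
          orthogonal_transformation_reflection F 3(1) sw tau)
    then have HV: "((w \<bullet> v + w \<bullet> u) / (1 + t)) *\<^sub>R (v + u) - w \<in> V"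
      "((w' \<bullet> v + w' \<bullet> u) / (1 + t)) *\<^sub>R (v + u) - w' \<in> V"
      using turn FN[OF w] FN[OF w'] 3(1) by (auto simp: in_N)
    have w'u: "w' \<bullet> u = 2 * t\<^sup>2 - w \<bullet> u"
      using vu by (simp add: w'_def inner_diff_left power2_eq_square)
    have "w \<noteq> u" using 3(2) u tau by metis
    have "w' \<noteq> u"
    proof
      assume "w' = u"
      then have "w = (2 * t) *\<^sub>R v - u" by (simp add: w'_def algebra_simps)
      then have "?\<tau> w = w"
        by (simp add: orthogonal_transformation_diff orthogonal_transformation_scaleR
            orthogonal_transformation_reflection tau)
      then show False using 3(2) w by simp
    qed
    consider "t\<^sup>2 < w \<bullet> u" | "t\<^sup>2 < w' \<bullet> u" | "w \<bullet> u = t\<^sup>2" using w'u by linarith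
    then show ?thesis
    proof cases
      case 1
      then show ?thesis using rectangle_half_turn_impossible[OF v four u w \<open>w \<noteq> u\<close>] HV by blast
    next
      case 2
      then show ?thesis using rectangle_half_turn_impossible[OF v four u w' \<open>w' \<noteq> u\<close>] HV by blast
    next
      (* here N v is a square, hence symmetric about its diagonals *)
      case square: 3
      have "w' = w \<or> w' = ?\<tau> w"
        unfolding n_def
        by (rule mirror_pair[OF cross_N_nonzero[OF v u]])
           (use w w' w'u square unit in \<open>auto simp: in_N\<close>)
      moreover have "w' \<noteq> w"
      proof
        assume "w' = w"
        then have "w' \<bullet> w = 1" using w unit by (simp add: in_N)
        then have "t\<^sup>2 = 1" using w unit
          by (simp add: w'_def in_N inner_diff_left inner_diff_right inner_commute power2_eq_square)
        then show False using t_sq by simp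
      qed
      ultimately show ?thesis using w' 3(2) by auto
    qed
  qed
qed

lemma edge_reflection_N:
  assumes v: "v \<in> V" and u: "u \<in> N v"
  shows "reflection (v - u) ` N v = N u"
proof (rule card_subset_eq[OF fin_N])
  show "reflection (v - u) ` N v \<subseteq> N u" using edge_reflection_N_subset[OF v u] by auto
  have "inj (reflection (v - u))"
    by (rule orthogonal_transformation_inj[OF orthogonal_transformation_reflection])
  then have "card (reflection (v - u) ` N v) = card (N v)"
    by (simp add: card_image inj_on_subset)
  then show "card (reflection (v - u) ` N v) = card (N u)"
    using card_N_eq[of v u] v u by (simp add: in_N)
qed

text \<open>The neighbours of a vertex \<open>w\<close> determine those of an adjacent vertex \<open>y\<close> by reflection in the edge. Hence an
orthogonal map that is compatible with \<open>V\<close> around one vertex is compatible with it around the adjacent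
vertices, and so everywhere.\<close>

lemma edge_reflection_V:
  assumes v: "v \<in> V" and u: "u \<in> N v" and x: "x \<in> V"
  shows "reflection (v - u) x \<in> V"
proof -
  let ?\<sigma> = "reflection (v - u)"
  note orth = orthogonal_transformation_reflection[of "v - u"]
  let ?W = "{x \<in> V. ?\<sigma> x \<in> V \<and> ?\<sigma> ` N x = N (?\<sigma> x)}"
  have "?W = V"
  proof (rule connected)
    have "v \<in> ?W"
      using edge_reflection_swap[OF v u] edge_reflection_N[OF v u] v u by (simp add: in_N)
    then show "?W \<noteq> {}" by blast
    fix w assume w: "w \<in> ?W"
    show "N w \<subseteq> ?W"
    proof
      fix y assume y: "y \<in> N w"
      then have \<sigma>y: "?\<sigma> y \<in> N (?\<sigma> w)" using w by blast
      have "N (?\<sigma> y) = reflection (?\<sigma> w - ?\<sigma> y) ` N (?\<sigma> w)"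
        using edge_reflection_N[OF _ \<sigma>y] w by simp
      also have "\<dots> = (\<lambda>z. reflection (?\<sigma> (w - y)) (?\<sigma> z)) ` N w"
      proof -
        have "N (?\<sigma> w) = ?\<sigma> ` N w" using w by simp
        then show ?thesis by (simp only: image_image orthogonal_transformation_diff[OF orth])
      qed
      also have "\<dots> = ?\<sigma> ` (reflection (w - y) ` N w)"
        by (simp add: image_image reflection_conjugate[OF orth])
      also have "\<dots> = ?\<sigma> ` N y" using edge_reflection_N[OF _ y] w by simp
      finally show "y \<in> ?W" using y \<sigma>y by (simp add: in_N)
    qed
  qed auto
  then show ?thesis using x by auto
qed

section \<open>Two edges at a common vertex\<close>

lemma edge_reflection_eq:
  assumes "v \<in> V" "u \<in> N v" "w \<in> N v"
  shows "reflection (v - u) w = w + ((t - w \<bullet> u) / (1 - t)) *\<^sub>R (u - v)"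
proof -
  have "(v - u) \<bullet> (v - u) = 2 * (1 - t)" "w \<bullet> (v - u) = t - w \<bullet> u"
    using assms unit by (simp_all add: in_N inner_diff_left inner_diff_right inner_commute)
  then have "2 * (w \<bullet> (v - u)) / ((v - u) \<bullet> (v - u)) = (t - w \<bullet> u) / (1 - t)"
    by (simp only: mult_divide_mult_cancel_left)
  then have "reflection (v - u) w = w - ((t - w \<bullet> u) / (1 - t)) *\<^sub>R (v - u)"
    by (simp only: reflection_def)
  then show ?thesis by (simp add: algebra_simps)
qed

text \<open>Consecutive vertices \<open>p\<close>, \<open>q\<close>, \<open>r\<close> of an equilateral and equiangular plane polygon are followed by the mirror image
of \<open>p\<close> about the perpendicular bisector of \<open>q\<close> and \<open>r\<close>. The ratio \<open>\<kappa>\<close> of the diagonal from \<open>p\<close> to this image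
to a side stays the same along the walk.\<close>

lemma face_walk_step:
  assumes q: "q \<in> V" and p: "p \<in> N q" and r: "r \<in> N q" and \<kappa>: "(t - p \<bullet> r) / (1 - t) = \<kappa>"
  shows "p + \<kappa> *\<^sub>R (r - q) \<in> N r" "q \<bullet> (p + \<kappa> *\<^sub>R (r - q)) = p \<bullet> r"
proof -
  have eq: "p + \<kappa> *\<^sub>R (r - q) = reflection (q - r) p"
    using edge_reflection_eq[OF q r p] \<kappa> by simp
  show "p + \<kappa> *\<^sub>R (r - q) \<in> N r" unfolding eq by (rule edge_reflection_N_subset[OF q r p])
  show "q \<bullet> (p + \<kappa> *\<^sub>R (r - q)) = p \<bullet> r"
    unfolding eq reflection_self_adjoint[symmetric] edge_reflection_swap[OF q r] by (rule inner_commute)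
qed

lemma close_eq:
  assumes "x \<in> V" "y \<in> V" "(x - y) \<bullet> (x - y) < 2 * (1 - t)"
  shows "x = y"
  using assms unit sep[of x y] by (force simp: inner_diff_left inner_diff_right inner_commute)

text \<open>Put \<open>\<kappa> = 1 + y\<close>, so that \<open>y\<close> is twice the cosine of the exterior angle of the polygon through
\<open>w\<close>, \<open>v\<close>, \<open>u\<close>. The point after \<open>u\<close> has distance \<open>\<kappa>\<close> from \<open>w\<close>, in units of the edge length,
which forces \<open>\<kappa> = 0\<close> (a triangle) or \<open>1 \<le> \<kappa>\<close>. If \<open>0 < y < 1\<close>, the point five steps after
\<open>w\<close> has distance \<open>\<bar>1 - y - y * y\<bar> < 1\<close> from \<open>w\<close>, so it is \<open>w\<close> and the polygon is a regular
pentagon, for which \<open>\<kappa>\<close> is the golden ratio.\<close>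

lemma diagonal_ratio_cases:
  assumes v: "v \<in> V" and u: "u \<in> N v" and w: "w \<in> N v" and uw: "w \<noteq> u"
    and \<kappa>: "\<kappa> = (t - w \<bullet> u) / (1 - t)"
  shows "\<kappa> = 0 \<or> \<kappa> = 1 \<or> \<kappa> = golden_ratio \<or> 2 \<le> \<kappa>"
proof -
  have vV: "v \<bullet> v = 1" "u \<bullet> u = 1" "w \<bullet> w = 1" "u \<bullet> v = t" "w \<bullet> v = t"
    using v u w unit by (auto simp: in_N)
  have "0 \<le> \<kappa>" using \<kappa> sep[of w u] uw u w t_lt_1 by (simp add: in_N)
  have edge: "(u - v) \<bullet> (u - v) = 2 * (1 - t)"
    using vV by (simp add: inner_diff_left inner_diff_right inner_commute)
  define p3 where "p3 = w + \<kappa> *\<^sub>R (u - v)"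
  have p3: "p3 \<in> N u" "v \<bullet> p3 = w \<bullet> u"
    unfolding p3_def using face_walk_step[OF v w u] \<kappa> by auto
  define p4 where "p4 = v + \<kappa> *\<^sub>R (p3 - u)"
  have uV: "u \<in> V" "v \<in> N u" using u N_sym[OF v u] by (auto simp: in_N)
  have p4: "p4 \<in> N p3" "u \<bullet> p4 = v \<bullet> p3"
    unfolding p4_def using face_walk_step[OF uV p3(1)] \<kappa> p3(2) by auto
  define p5 where "p5 = u + \<kappa> *\<^sub>R (p4 - p3)"
  have p3V: "p3 \<in> V" "u \<in> N p3" using p3 N_sym[OF uV(1) p3(1)] by (auto simp: in_N)
  have p5: "p5 \<in> N p4"
    unfolding p5_def using face_walk_step(1)[OF p3V p4(1)] \<kappa> p3(2) p4(2) by auto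
  consider "\<kappa> < 1" | "\<kappa> = 1" | "1 < \<kappa>" "\<kappa> < 2" | "2 \<le> \<kappa>" by linarith
  then show ?thesis
  proof cases
    case 1
    have "\<kappa> * \<kappa> < 1" using 1 \<open>0 \<le> \<kappa>\<close> mult_strict_mono'[of \<kappa> 1 \<kappa> 1] by simp
    have d: "(p3 - w) \<bullet> (p3 - w) = \<kappa> * \<kappa> * (2 * (1 - t))"
      by (simp add: p3_def edge)
    also have "\<dots> < 1 * (2 * (1 - t))"
      using \<open>\<kappa> * \<kappa> < 1\<close> t_lt_1 by (intro mult_strict_right_mono) auto
    finally have "p3 = w" using close_eq p3V w by (simp add: in_N)
    then show ?thesis using d t_lt_1 by simp
  next
    case 3
    define y where "y = \<kappa> - 1"
    have y: "0 < y" "y < 1" using 3 by (auto simp: y_def)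
    define e0 where "e0 = v - w"
    define e1 where "e1 = u - v"
    have e: "e0 \<bullet> e0 = 2 * (1 - t)" "e1 \<bullet> e1 = 2 * (1 - t)" "e0 \<bullet> e1 = y * (1 - t)"
    proof -
      have "y * (1 - t) = 2 * t - 1 - w \<bullet> u" using t_lt_1 by (simp add: y_def \<kappa> field_simps)
      then show "e0 \<bullet> e1 = y * (1 - t)"
        using vV by (simp add: e0_def e1_def inner_diff_left inner_diff_right inner_commute)
    qed (use vV edge in \<open>simp_all add: e0_def e1_def inner_diff_left inner_diff_right inner_commute\<close>)
    have uw': "u = w + e0 + e1" "v = w + e0" "\<kappa> = y + 1" by (simp_all add: e0_def e1_def y_def)
    have dp: "p5 - w = (1 - y - y * y) *\<^sub>R (e0 - y *\<^sub>R e1)"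
      by (simp add: p5_def p4_def p3_def uw' algebra_simps scaleR_2)
    have "(e0 - y *\<^sub>R e1) \<bullet> (e0 - y *\<^sub>R e1) = 2 * (1 - t)"
    proof -
      have "(e0 - y *\<^sub>R e1) \<bullet> (e0 - y *\<^sub>R e1) = e0 \<bullet> e0 - 2 * y * (e0 \<bullet> e1) + y * y * (e1 \<bullet> e1)"
        by (simp add: inner_diff_left inner_diff_right inner_commute)
      then show ?thesis unfolding e by (simp add: algebra_simps)
    qed
    then have d: "(p5 - w) \<bullet> (p5 - w) = (1 - y - y * y)\<^sup>2 * (2 * (1 - t))"
      by (simp add: dp power2_eq_square)
    have "y * y < 1" "0 < y * y" using y mult_strict_mono'[of y 1 y 1] by simp_all
    then have "\<bar>1 - y - y * y\<bar> < 1" using y by linarith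
    then have "(1 - y - y * y)\<^sup>2 < 1" by (simp add: abs_square_less_1)
    then have "(p5 - w) \<bullet> (p5 - w) < 1 * (2 * (1 - t))"
      unfolding d using t_lt_1 by (intro mult_strict_right_mono) auto
    then have "p5 = w" using close_eq p5 w by (simp add: in_N)
    then have "1 - y - y * y = 0" using d t_lt_1 by simp
    then have "\<kappa> * \<kappa> = \<kappa> + 1" by (simp add: y_def algebra_simps)
    then show ?thesis using golden_ratio_unique 3 by simp
  qed auto
qed

section \<open>The possible edge lengths\<close>

text \<open>The sum of the three neighbours gives their mutual inner products, and the diagonal ratio is
\<open>(1 + 3 * t) / 2 < 2\<close>. The condition on the triple product, here and below, says that \<open>v\<close>, \<open>u\<close>,
\<open>w\<close> are linearly independent.\<close>

lemma three_cases:
  assumes v: "v \<in> V" and three: "card (N v) = 3"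
  shows "\<exists>u w. u \<in> N v \<and> w \<in> N v \<and> w \<bullet> u = (3 * t\<^sup>2 - 1) / 2 \<and> w \<bullet> (v \<times> u) \<noteq> 0
    \<and> (t = -1/3 \<or> t = 1/3 \<or> t = (2 * golden_ratio - 1) / 3)"
proof -
  obtain u w z where Nv: "N v = {u, w, z}" "u \<noteq> w" "u \<noteq> z" "w \<noteq> z"
    using three by (auto simp: card_3_iff)
  have sum: "u + w + z = (3 * t) *\<^sub>R v"
    using sum_N[OF v] three Nv by (simp add: add.assoc)
  have ip: "u \<bullet> v = t" "w \<bullet> v = t" "z \<bullet> v = t" "u \<bullet> u = 1" "w \<bullet> w = 1" "z \<bullet> z = 1"
    using Nv unit by (auto simp: N_def)
  have "(u + w + z) \<bullet> u = 3 * t\<^sup>2" "(u + w + z) \<bullet> w = 3 * t\<^sup>2" "(u + w + z) \<bullet> z = 3 * t\<^sup>2"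
    unfolding sum using ip by (simp_all add: inner_commute power2_eq_square)
  then have s: "w \<bullet> u = (3 * t\<^sup>2 - 1) / 2"
    using ip by (simp add: inner_add_left inner_add_right inner_commute)
  have "2 * (t - w \<bullet> u) = (1 + 3 * t) * (1 - t)"
    unfolding s by (simp add: power2_eq_square field_simps)
  then have "(1 + 3 * t) / 2 = (t - w \<bullet> u) / (1 - t)" using t_lt_1 by (simp add: field_simps)
  then have "(1 + 3 * t) / 2 = 0 \<or> (1 + 3 * t) / 2 = 1 \<or> (1 + 3 * t) / 2 = golden_ratio
      \<or> 2 \<le> (1 + 3 * t) / 2"
    using diagonal_ratio_cases[OF v, of u w "(1 + 3 * t) / 2"] Nv by blast
  then have "t = -1/3 \<or> t = 1/3 \<or> t = (2 * golden_ratio - 1) / 3" using t_lt_1 by (auto simp: field_simps)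
  moreover have "w \<bullet> (v \<times> u) \<noteq> 0"
  proof
    assume "w \<bullet> (v \<times> u) = 0"
    moreover from this have "(u + w + z) \<bullet> (v \<times> u) = 0 + 0 + z \<bullet> (v \<times> u)"
      by (simp only: inner_add_left dot_cross_self)
    ultimately have "(v \<times> u) \<bullet> y = (v \<times> u) \<bullet> v" if "y \<in> N v" for y
      using that sum Nv by (auto simp: dot_cross_self inner_commute)
    then have "v \<times> u = 0" by (rule edges_span[OF v])
    then show False using cross_N_nonzero[OF v] Nv by simp
  qed
  ultimately show ?thesis using Nv s by blast
qed

text \<open>With this value of \<open>t\<close> the vertices in the plane through an edge and the centre form a regular decagon, because
a half-turn about the line through a vertex maps its neighbours to its neighbours; the edge vector, stretched by the golden ratio, is
again a vertex.\<close>

lemma four_edge_vector: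
  assumes four: "\<And>v. v \<in> V \<Longrightarrow> card (N v) = 4" and t: "t = golden_ratio / 2"
    and p: "p \<in> V" and q: "q \<in> N p"
  shows "golden_ratio *\<^sub>R (q - p) \<in> V"
proof -
  let ?g = golden_ratio
  have t2: "2 * t = ?g" using t by simp
  have anti: "?g *\<^sub>R x - y \<in> N x" if "x \<in> V" "y \<in> N x" for x y
    using N_antipode[OF that(1) four[OF that(1)] that(2)] by (simp only: t2)
  define a where "a = ?g *\<^sub>R q - p"
  have qV: "q \<in> V" using q by (simp add: in_N)
  have "a \<in> N q" unfolding a_def by (rule anti[OF qV N_sym[OF p q]])
  then have a: "a \<in> V" "q \<in> N a" using N_sym[OF qV] by (auto simp: in_N)
  have b: "?g *\<^sub>R a - q \<in> N a" by (rule anti[OF a])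
  have "?g *\<^sub>R a - q = (?g * ?g) *\<^sub>R q - ?g *\<^sub>R p - q" by (simp add: a_def algebra_simps)
  also have "\<dots> = ?g *\<^sub>R (q - p)" by (simp add: golden_ratio_square algebra_simps)
  finally show ?thesis using b by (simp add: in_N)
qed

text \<open>The diagonal ratios at two adjacent corners of the rectangle of neighbours add up to \<open>2 * t\<close>. As
\<open>t < 1\<close>, one of them vanishes and the other one is 0, 1 or the golden ratio.\<close>

lemma four_cases:
  assumes four: "\<And>v. v \<in> V \<Longrightarrow> card (N v) = 4" and v: "v \<in> V"
  shows "\<exists>u w. u \<in> N v \<and> w \<in> N v \<and> w \<bullet> u = t \<and> w \<bullet> (v \<times> u) \<noteq> 0
    \<and> N v = {u, w, (2 * t) *\<^sub>R v - u, (2 * t) *\<^sub>R v - w} \<and> (t = 0 \<or> t = 1/2 \<or> t = golden_ratio / 2)"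
proof -
  obtain u where u: "u \<in> N v" using four[OF v] by fastforce
  have "\<not> N v \<subseteq> {u, (2 * t) *\<^sub>R v - u}"
  proof
    assume "N v \<subseteq> {u, (2 * t) *\<^sub>R v - u}"
    then have "card (N v) \<le> card {u, (2 * t) *\<^sub>R v - u}" by (intro card_mono) auto
    also have "\<dots> \<le> 2" by (simp add: card_insert_if)
    finally show False using four[OF v] by simp
  qed
  then obtain w where w: "w \<in> N v" "w \<noteq> u" "w \<noteq> (2 * t) *\<^sub>R v - u" by auto
  define w' where "w' = (2 * t) *\<^sub>R v - w"
  have Nv: "N v = {u, w, (2 * t) *\<^sub>R v - u, w'}"
    using N_four[OF v four[OF v] u w] by (simp add: w'_def)
  have ww: "w = (2 * t) *\<^sub>R v - w'" by (simp add: w'_def)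
  have w': "w' \<in> N v" "w' \<noteq> u" using Nv w(3) by (auto simp: w'_def algebra_simps)
  have w'u: "w' \<bullet> u = 2 * t\<^sup>2 - w \<bullet> u"
    using u by (simp add: w'_def in_N inner_diff_left inner_commute[of v u] power2_eq_square)
  define \<kappa> where "\<kappa> x = (t - x \<bullet> u) / (1 - t)" for x
  have \<kappa>: "\<kappa> x = 0 \<or> \<kappa> x = 1 \<or> \<kappa> x = golden_ratio \<or> 2 \<le> \<kappa> x" if "x = w \<or> x = w'" for x
    using diagonal_ratio_cases[OF v u w(1,2)] diagonal_ratio_cases[OF v u w'] that by (auto simp: \<kappa>_def)
  have "\<kappa> w + \<kappa> w' = (t - w \<bullet> u + (t - w' \<bullet> u)) / (1 - t)"
    unfolding \<kappa>_def by (rule add_divide_distrib[symmetric])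
  also have "t - w \<bullet> u + (t - w' \<bullet> u) = 2 * t * (1 - t)"
    by (simp add: w'u power2_eq_square algebra_simps)
  finally have "\<kappa> w + \<kappa> w' = 2 * t" using t_lt_1 by simp
  moreover have "\<kappa> w < 2 \<or> \<kappa> w' < 2" using calculation t_lt_1 by linarith
  ultimately have zero: "\<kappa> w = 0 \<or> \<kappa> w' = 0" and t: "t = 0 \<or> t = 1/2 \<or> t = golden_ratio / 2"
    using \<kappa>[of w] \<kappa>[of w'] t_lt_1 golden_ratio_bounds by auto
  have "x \<bullet> u = t" if "\<kappa> x = 0" for x using that t_lt_1 by (simp add: \<kappa>_def)
  moreover have vol: "x \<bullet> (v \<times> u) \<noteq> 0" if "x = w \<or> x = w'" for x
  proof
    assume "x \<bullet> (v \<times> u) = 0"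
    then have "w \<bullet> (v \<times> u) = 0" "w' \<bullet> (v \<times> u) = 0"
      using that by (auto simp: w'_def inner_diff_left dot_cross_self)
    then have "(v \<times> u) \<bullet> y = (v \<times> u) \<bullet> v" if "y \<in> N v" for y
      using that Nv by (auto simp: dot_cross_self inner_commute[of "v \<times> u"] inner_diff_left)
    then have "v \<times> u = 0" by (rule edges_span[OF v])
    then show False using cross_N_nonzero[OF v u] by simp
  qed
  ultimately consider "w \<bullet> u = t" | "w' \<bullet> u = t" using zero by auto
  then show ?thesis
  proof cases
    case 1
    then show ?thesis using u w t Nv vol w'_def by blast
  next
    case 2
    moreover have "N v = {u, w', (2 * t) *\<^sub>R v - u, (2 * t) *\<^sub>R v - w'}"
      unfolding ww[symmetric] using Nv by blast
    ultimately show ?thesis using u w' t vol by blast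
  qed
qed

text \<open>The unit vectors \<open>?x\<close> and \<open>y\<close> along the sides of the rectangle of neighbours of \<open>v\<close> are themselves vertices, both
orthogonal to \<open>v\<close>. A symmetry that fixes \<open>v\<close> and maps \<open>?x\<close> to \<open>y\<close> would map the short
sides of the rectangle to the long ones.\<close>

lemma no_icosidodecahedron:
  assumes four: "\<And>v. v \<in> V \<Longrightarrow> card (N v) = 4"
  shows "t \<noteq> golden_ratio / 2"
proof
  assume t: "t = golden_ratio / 2"
  let ?g = golden_ratio
  have t2: "2 * t = ?g" using t by simp
  have gg: "?g * (?g * z) = (?g + 1) * z" for z
    by (simp only: mult.assoc[symmetric] golden_ratio_square)
  obtain v where v: "v \<in> V" using ex_V by auto
  obtain u w where u: "u \<in> N v" and w: "w \<in> N v" and wu: "w \<bullet> u = t"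
    and Nv: "N v = {u, w, ?g *\<^sub>R v - u, ?g *\<^sub>R v - w}"
    using four_cases[OF four v] t by auto
  have ip: "u \<bullet> v = t" "w \<bullet> v = t" "v \<bullet> v = 1" "u \<bullet> u = 1" "w \<bullet> w = 1" "u \<in> V" "w \<in> V"
    using u w v unit by (auto simp: in_N)
  have wNu: "w \<in> N u" using ip wu by (simp add: in_N)
  have xV: "?g *\<^sub>R (u - w) \<in> V" (is "?x \<in> V")
    by (rule four_edge_vector[OF four t ip(7) N_sym[OF ip(6) wNu]])
  define a where "a = ?g *\<^sub>R u - v"
  have a: "a \<in> N u"
    using N_antipode[OF ip(6) four[OF ip(6)] N_sym[OF v u]] by (simp only: t2 a_def)
  define y where "y = u + w - ?g *\<^sub>R v"
  have "(t - w \<bullet> a) / (1 - t) = ?g"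
  proof -
    have "w \<bullet> a = ?g * t - t" using ip wu by (simp add: a_def inner_diff_right)
    then show ?thesis using t_lt_1 golden_ratio_square by (simp add: t field_simps)
  qed
  then have "reflection (u - a) w = w + ?g *\<^sub>R (a - u)"
    using edge_reflection_eq[OF ip(6) a wNu] by simp
  also have "\<dots> = y"
    by (simp add: a_def y_def algebra_simps golden_ratio_square)
  finally have yV: "y \<in> V" using edge_reflection_V[OF ip(6) a ip(7)] by simp
  have "v \<bullet> u = t" "v \<bullet> w = t" using ip by (simp_all add: inner_commute)
  then have "v \<bullet> ?x = v \<bullet> y"
    using ip(3) t2 by (simp add: y_def inner_diff_right inner_add_right)
  then obtain F where F: "orthogonal_transformation F" "F ` V = V" "F v = v" "F ?x = y"
    using homog[of v ?x v y] v xV yV by auto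
  have FN: "F u \<in> N v" using N_image[OF F(1,2), of v] u F(3) by auto
  have "F u \<bullet> y = u \<bullet> ?x" using orthogonal_transformation_inner[OF F(1), of u ?x] F(4) by simp
  also have "\<dots> = (?g - 1) / 2"
    using ip wu golden_ratio_square by (simp add: inner_diff_right inner_commute t field_simps)
  finally have Fu: "F u \<bullet> y = (?g - 1) / 2" .
  have "u \<bullet> y = 1 / 2" "w \<bullet> y = 1 / 2" "v \<bullet> y = 0"
    using ip wu golden_ratio_square
    by (simp_all add: y_def inner_diff_right inner_add_right inner_commute t field_simps)
  then have "F u \<bullet> y = 1 / 2 \<or> F u \<bullet> y = - (1 / 2)"
    using FN Nv by (auto simp: inner_diff_left)
  then show False using Fu golden_ratio_bounds by auto
qed

text \<open>Otherwise, by transitivity, the neighbours would come in antipodal pairs.\<close>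

lemma no_antipode_odd:
  assumes v: "v \<in> V" and odd: "odd (card (N v))" and u: "u \<in> N v"
  shows "(2 * t) *\<^sub>R v - u \<notin> N v"
proof
  let ?opp = "\<lambda>a. (2 * t) *\<^sub>R v - a"
  assume opp: "?opp u \<in> N v"
  have "even (card (N v))"
  proof (rule even_card_unique_partner[OF fin_N, where R = "\<lambda>a b. a + b = (2 * t) *\<^sub>R v"])
    fix a assume a: "a \<in> N v"
    show "a + a \<noteq> (2 * t) *\<^sub>R v"
    proof
      assume "a + a = (2 * t) *\<^sub>R v"
      then have "(a + a) \<bullet> a = ((2 * t) *\<^sub>R v) \<bullet> a" by (rule arg_cong)
      then have "a \<bullet> a + a \<bullet> a = 2 * t * (v \<bullet> a)"
        by (simp only: inner_add_left inner_scaleR_left)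
      then have "t\<^sup>2 = 1" using a unit
        by (simp add: in_N inner_commute power2_eq_square)
      then show False using t_sq by simp
    qed
    obtain F where F: "orthogonal_transformation F" "F ` N v = N v" "F v = v" "F u = a"
      using stabilizer_transitive[OF v u a] by auto
    have "F (?opp u) = ?opp a"
      using F by (simp add: orthogonal_transformation_diff orthogonal_transformation_scaleR)
    then have "?opp a \<in> N v" using opp F(2) by (metis imageI)
    then show "\<exists>!b. b \<in> N v \<and> a + b = (2 * t) *\<^sub>R v"
      by (intro ex1I[of _ "?opp a"]) (auto simp: algebra_simps)
  qed (simp add: add.commute)
  then show False using odd by simp
qed

text \<open>In terms of the angle \<open>\<phi>\<close> between \<open>w\<close> and \<open>u\<close>, measured around the axis \<open>v\<close>, this is the formula for the
cosine of \<open>2 * \<phi>\<close>.\<close>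

lemma mirror_pair_inner:
  assumes v: "v \<in> V" and u: "u \<in> N v" and w: "w \<in> N v"
  shows "w \<bullet> reflection (v \<times> u) w = 2 * t\<^sup>2 - 1 + 2 * (w \<bullet> u - t\<^sup>2)\<^sup>2 / (1 - t\<^sup>2)"
proof -
  define n where "n = v \<times> u"
  define w1 where "w1 = reflection n w"
  define \<beta> where "\<beta> = 2 * (w \<bullet> u - t\<^sup>2) / (1 - t\<^sup>2)"
  define \<alpha> where "\<alpha> = (2 - \<beta>) * t"
  have n0: "n \<noteq> 0" using cross_N_nonzero[OF v u] by (simp add: n_def)
  have ip: "v \<bullet> v = 1" "u \<bullet> u = 1" "w \<bullet> w = 1" "u \<bullet> v = t" "w \<bullet> v = t"
    using v u w unit by (auto simp: in_N)
  have fixed: "reflection n v = v" "reflection n u = u" "reflection n n = - n"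
    using n0 by (simp_all add: n_def reflection_orthogonal dot_cross_self)
       (simp add: reflection_def scaleR_2)
  have w1: "w1 \<bullet> v = t" "w1 \<bullet> u = w \<bullet> u" "w1 \<bullet> n = - (w \<bullet> n)" "w1 \<bullet> w1 = 1"
    using ip by (simp_all add: w1_def reflection_self_adjoint fixed)
  have b: "\<beta> * (1 - t * t) = 2 * (w \<bullet> u - t * t)"
    using t_sq by (simp add: \<beta>_def power2_eq_square)
  have "w + w1 - (\<alpha> *\<^sub>R v + \<beta> *\<^sub>R u) = 0"
  proof (rule orthogonal_to_frame[of v u])
    show "v \<times> u \<noteq> 0" using n0 by (simp add: n_def)
    show "(w + w1 - (\<alpha> *\<^sub>R v + \<beta> *\<^sub>R u)) \<bullet> v = 0"
      using ip w1 by (simp add: inner_diff_left inner_add_left \<alpha>_def algebra_simps)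
    have "v \<bullet> u = t" using ip by (simp add: inner_commute)
    then show "(w + w1 - (\<alpha> *\<^sub>R v + \<beta> *\<^sub>R u)) \<bullet> u = 0"
      using ip w1 b by (simp add: inner_diff_left inner_add_left \<alpha>_def algebra_simps)
    show "(w + w1 - (\<alpha> *\<^sub>R v + \<beta> *\<^sub>R u)) \<bullet> (v \<times> u) = 0"
      using w1(3) by (simp add: inner_diff_left inner_add_left dot_cross_self n_def)
  qed
  then have "w \<bullet> (w + w1) = w \<bullet> (\<alpha> *\<^sub>R v + \<beta> *\<^sub>R u)" by simp
  then have "w \<bullet> w1 = \<alpha> * t + \<beta> * (w \<bullet> u) - 1" using ip by (simp add: inner_add_right)
  also have "\<dots> = 2 * t\<^sup>2 - 1 + \<beta> * (w \<bullet> u - t\<^sup>2)"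
    by (simp add: \<alpha>_def power2_eq_square algebra_simps)
  finally show ?thesis by (simp add: w1_def n_def \<beta>_def power2_eq_square)
qed

text \<open>The neighbours other than \<open>u\<close> form two pairs of mirror images. Let \<open>x\<close> and \<open>y\<close> be the cosines of
the angles that the two pairs make with \<open>u\<close> around the axis \<open>v\<close>. The sum of all neighbours gives
\<open>x + y = - 1 / 2\<close>, and doubling an angle leads from \<open>x\<close> to \<open>x\<close> or \<open>y\<close>, and likewise from \<open>y\<close>. So the
neighbours form a regular pentagon, and the larger cosine is \<open>(golden_ratio - 1) / 2\<close>. The diagonal ratio for
this angle is less than 1, hence 0, which determines \<open>t\<close>.\<close>

lemma five_cases:
  assumes v: "v \<in> V" and five: "card (N v) = 5"
  shows "\<exists>u w. u \<in> N v \<and> w \<in> N v \<and> w \<bullet> u = t \<and> w \<bullet> (v \<times> u) \<noteq> 0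
    \<and> t * (3 - golden_ratio) = golden_ratio - 1"
proof -
  obtain u where u: "u \<in> N v" using five by fastforce
  let ?\<tau> = "reflection (v \<times> u)"
  have odd: "odd (card (N v))" using five by simp
  have \<tau>N: "?\<tau> x \<in> N v" if "x \<in> N v" for x by (rule N_mirror_odd[OF v odd u that])
  have \<tau>u: "?\<tau> u = u" by (simp add: reflection_orthogonal dot_cross_self)
  have \<tau>ip: "?\<tau> x \<bullet> u = x \<bullet> u" for x by (simp add: reflection_self_adjoint \<tau>u)
  have \<tau>eq: "?\<tau> x = y \<longleftrightarrow> x = ?\<tau> y" for x y by (metis reflection_reflection)
  have no_fix: "?\<tau> x \<noteq> x" if x: "x \<in> N v" "x \<noteq> u" for x
  proof
    assume "?\<tau> x = x"
    then have "2 * t\<^sup>2 - 1 + 2 * (x \<bullet> u - t\<^sup>2)\<^sup>2 / (1 - t\<^sup>2) = 1"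
      using mirror_pair_inner[OF v u x(1)] x unit by (simp add: in_N)
    then have "(x \<bullet> u - t\<^sup>2)\<^sup>2 = (1 - t\<^sup>2)\<^sup>2"
      using t_sq by (simp add: field_simps power2_eq_square)
    then have "x \<bullet> u = 1 \<or> x \<bullet> u = 2 * t\<^sup>2 - 1" by (simp add: power2_eq_iff)
    moreover have "x \<bullet> u \<noteq> 1" using sep[of x u] x u t_lt_1 by (simp add: in_N)
    ultimately have "x \<bullet> u = 2 * t\<^sup>2 - 1" by simp
    then have "(x + u - (2 * t) *\<^sub>R v) \<bullet> (x + u - (2 * t) *\<^sub>R v) = 0"
      using x u v unit by (simp add: in_N inner_add_left inner_add_right inner_diff_left
          inner_diff_right inner_commute power2_eq_square)
    then have "x + u - (2 * t) *\<^sub>R v = 0" by (simp only: inner_eq_zero_iff)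
    then have "x = (2 * t) *\<^sub>R v - u" by (simp add: algebra_simps)
    then show False using no_antipode_odd[OF v odd u] x by simp
  qed
  have "card (N v - {u}) = 4" using five u by (simp add: card_Diff_singleton fin_N)
  then have "N v - {u} \<noteq> {}" by (metis card.empty zero_neq_numeral)
  then obtain w where w: "w \<in> N v" "w \<noteq> u" by blast
  define w1 where "w1 = ?\<tau> w"
  have w1: "w1 \<in> N v" "w1 \<noteq> w" "w1 \<noteq> u" "w1 \<bullet> u = w \<bullet> u" "?\<tau> w1 = w"
    using \<tau>N[OF w(1)] no_fix[OF w] w(2) \<tau>u \<tau>ip \<tau>eq[of w u] by (auto simp: w1_def)
  have "card (N v - {u, w, w1}) = 2"
    using five u w w1 by (simp add: card_Diff_subset card_insert_if)
  then have "N v - {u, w, w1} \<noteq> {}" by (metis card.empty zero_neq_numeral)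
  then obtain z where z: "z \<in> N v" "z \<noteq> u" "z \<noteq> w" "z \<noteq> w1" by blast
  define z1 where "z1 = ?\<tau> z"
  have z1: "z1 \<in> N v" "z1 \<noteq> z" "z1 \<bullet> u = z \<bullet> u" "z1 \<noteq> u" "z1 \<noteq> w" "z1 \<noteq> w1"
    using \<tau>N[OF z(1)] no_fix[OF z(1,2)] z \<tau>u \<tau>ip w1(5)
      \<tau>eq[of z u] \<tau>eq[of z w] \<tau>eq[of z w1]
    by (auto simp: z1_def w1_def)
  have distinct: "card {u, w, w1, z, z1} = 5" using w w1 z z1 by (simp add: card_insert_if)
  have "{u, w, w1, z, z1} = N v"
    by (rule card_subset_eq[OF fin_N]) (use distinct five u w w1 z z1 in auto)
  then have Nv: "N v = {u, w, w1, z, z1}" ..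
  define s1 where "s1 = w \<bullet> u"
  define s2 where "s2 = z \<bullet> u"
  have "\<Sum>(N v) = u + w + w1 + z + z1"
    unfolding Nv using w w1 z z1 by (simp add: add.assoc)
  then have sumv: "u + w + w1 + z + z1 = (5 * t) *\<^sub>R v" using sum_N[OF v] five by simp
  have "(u + w + w1 + z + z1) \<bullet> u = 5 * t\<^sup>2"
    unfolding sumv using u by (simp add: in_N inner_commute[of v u] power2_eq_square)
  then have sum: "1 + 2 * s1 + 2 * s2 = 5 * t\<^sup>2"
    using u unit w1 z1 by (simp add: s1_def s2_def in_N inner_add_left)
  have mirror_inner: "a \<bullet> ?\<tau> a = s1 \<or> a \<bullet> ?\<tau> a = s2" if a: "a \<in> N v" "a \<noteq> u" for a
  proof -
    obtain F where F: "orthogonal_transformation F" "F ` N v = N v" "F u = a"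
      using stabilizer_transitive[OF v u a(1)] by auto
    obtain c where c: "c \<in> N v" "?\<tau> a = F c" using F(2) \<tau>N[OF a(1)] by (metis imageE)
    have "a \<bullet> ?\<tau> a = u \<bullet> c"
      using orthogonal_transformation_inner[OF F(1), of u c] by (simp add: F c)
    moreover have "c \<noteq> u" using no_fix[OF a] c F by auto
    ultimately show ?thesis
      using c Nv w1 z1 by (auto simp: s1_def s2_def inner_commute)
  qed
  define \<rho> where "\<rho> = 1 - t\<^sup>2"
  have \<rho>: "0 < \<rho>" using t_sq by (simp add: \<rho>_def)
  define x where "x = (s1 - t\<^sup>2) / \<rho>"
  define y where "y = (s2 - t\<^sup>2) / \<rho>"
  have s: "s1 = t\<^sup>2 + \<rho> * x" "s2 = t\<^sup>2 + \<rho> * y" using \<rho> by (simp_all add: x_def y_def)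
  have "\<rho> * (x + y) = \<rho> * (- 1/2)" using sum unfolding s by (simp add: \<rho>_def algebra_simps)
  then have "x + y = - 1/2" using \<rho> by (simp only: mult_cancel_left) simp
  then have xy: "y = - 1/2 - x" by simp
  have double: "2 * (r * r) - 1 = x \<or> 2 * (r * r) - 1 = y"
    if a: "a \<in> N v" "a \<noteq> u" and r: "a \<bullet> u = t\<^sup>2 + \<rho> * r" for a r
  proof -
    have "a \<bullet> ?\<tau> a = t\<^sup>2 + \<rho> * (2 * (r * r) - 1)"
    proof -
      have "a \<bullet> u - t\<^sup>2 = \<rho> * r" using r by simp
      then have "a \<bullet> ?\<tau> a = 2 * t\<^sup>2 - 1 + 2 * (\<rho> * r)\<^sup>2 / \<rho>"
        using mirror_pair_inner[OF v u a(1)] by (simp only: \<rho>_def[symmetric])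
      also have "2 * (\<rho> * r)\<^sup>2 / \<rho> = 2 * \<rho> * (r * r)" using \<rho> by (simp add: power2_eq_square)
      finally show ?thesis by (simp add: \<rho>_def algebra_simps)
    qed
    then have "\<rho> * (2 * (r * r) - 1) = \<rho> * x \<or> \<rho> * (2 * (r * r) - 1) = \<rho> * y"
      using mirror_inner[OF a] s by auto
    then show ?thesis using \<rho> by simp
  qed
  have dx: "2 * (x * x) - 1 = x \<or> 2 * (x * x) - 1 = y" using double[OF w] s by (simp add: s1_def)
  have dy: "2 * (y * y) - 1 = x \<or> 2 * (y * y) - 1 = y" using double[OF z(1,2)] s by (simp add: s2_def)
  have x1: "x \<noteq> 1"
    using sep[of w u] w u t_lt_1 s(1) by (auto simp: in_N \<rho>_def s1_def)
  let ?X = "(golden_ratio - 1) / 2"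
  have "2 * (x * x) - 1 \<noteq> x"
  proof
    assume "2 * (x * x) - 1 = x"
    then have "(x - 1) * (2 * x + 1) = 0" by (simp add: algebra_simps)
    then have "x = - 1/2" using x1 by auto
    then show False using dy xy by auto
  qed
  then have "4 * (x * x) + 2 * x - 1 = 0" using dx xy by auto
  moreover have "4 * ((x - ?X) * (x + golden_ratio / 2))
      = 4 * (x * x) + 2 * x - (golden_ratio * golden_ratio - golden_ratio)"
    by (simp add: field_simps)
  ultimately have "(x - ?X) * (x + golden_ratio / 2) = 0" by (simp add: golden_ratio_square)
  then have "x - ?X = 0 \<or> x + golden_ratio / 2 = 0" by (simp only: mult_eq_0_iff)
  then have "x = ?X \<or> y = ?X" using xy by argo
  then obtain a where a: "a \<in> N v" "a \<noteq> u" "a \<bullet> u = t\<^sup>2 + \<rho> * ?X"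
    using s w z unfolding s1_def s2_def by metis
  have ta: "t - a \<bullet> u = (1 - t) * (t - (1 + t) * ?X)"
    unfolding a(3) by (simp add: \<rho>_def power2_eq_square field_simps)
  then have "t - (1 + t) * ?X = (t - a \<bullet> u) / (1 - t)" using t_lt_1 by simp
  then have cases: "t - (1 + t) * ?X = 0 \<or> 1 \<le> t - (1 + t) * ?X"
    using diagonal_ratio_cases[OF v u a(1,2)] golden_ratio_bounds by fastforce
  have "0 < (1 + t) * ?X" using t_gt golden_ratio_bounds by (intro mult_pos_pos) auto
  then have zero: "t - (1 + t) * ?X = 0" using cases t_lt_1 by linarith
  have "a \<bullet> u = t" using ta unfolding zero by simp
  moreover have "t * (3 - golden_ratio) = golden_ratio - 1" using zero by (simp add: field_simps)
  moreover have "a \<bullet> (v \<times> u) \<noteq> 0" using no_fix[OF a(1,2)] reflection_orthogonal by blast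
  ultimately show ?thesis using u a by blast
qed

end

section \<open>Vertex sets determined by the edges at one vertex\<close>

lemma align_triple:
  fixes v u w a b c :: "real^3"
  assumes vol: "w \<bullet> (v \<times> u) \<noteq> 0" and r: "0 < r"
    and gram: "a \<bullet> a = r * (v \<bullet> v)" "b \<bullet> b = r * (u \<bullet> u)" "c \<bullet> c = r * (w \<bullet> w)"
      "a \<bullet> b = r * (v \<bullet> u)" "a \<bullet> c = r * (v \<bullet> w)" "b \<bullet> c = r * (u \<bullet> w)"
  shows "\<exists>L. orthogonal_transformation L \<and>
    sqrt r *\<^sub>R L v = a \<and> sqrt r *\<^sub>R L u = b \<and> sqrt r *\<^sub>R L w = c"
proof -
  define x where "x i = (if i = 0 then v else if i = 1 then u else w)" for i :: nat
  define y where "y i = (1 / sqrt r) *\<^sub>R (if i = 0 then a else if i = 1 then b else c)" for i :: nat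
  have img: "x ` {0, 1, 2} = {v, u, w}" by (auto simp: x_def)
  have span: "span (x ` {0, 1, 2}) = UNIV"
  proof (rule span_UNIV_if_no_normal)
    fix G assume "\<And>z. z \<in> x ` {0, 1, 2} \<Longrightarrow> G \<bullet> z = 0"
    then have G0: "G \<bullet> v = 0" "G \<bullet> u = 0" "G \<bullet> w = 0" unfolding img by auto
    have "v \<times> u \<noteq> 0" using vol by auto
    then obtain c where c: "G = c *\<^sub>R (v \<times> u)" using parallel_to_cross G0 by blast
    then have "c = 0" using G0(3) vol by (simp add: inner_commute)
    then show "G = 0" using c by simp
  qed
  have "\<exists>L. orthogonal_transformation L \<and> (\<forall>i\<in>{0, 1, 2}. L (x i) = y i)"
  proof (rule isometric_extension)
    fix i j :: nat assume "i \<in> {0, 1, 2}" "j \<in> {0, 1, 2}"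
    then show "x i \<bullet> x j = y i \<bullet> y j"
      using gram r by (auto simp: x_def y_def inner_commute)
  qed (use span in auto)
  then obtain L where L: "orthogonal_transformation L" "L v = y 0" "L u = y 1" "L w = y 2"
    by (auto simp: x_def)
  then show ?thesis using r by (intro exI[of _ L]) (simp add: y_def)
qed

text \<open>What identifies \<open>V\<close> once three of its points are known, freed of the normalisation to the unit sphere:
\<open>r\<close> is the square of the radius, \<open>t\<close> the inner product along an edge and \<open>k\<close> the degree. Reflections in edges and
the symmetries of the neighbours of a vertex produce new points; \<open>connected\<close> and
\<open>degree\<close> show that a set of points with enough neighbours is complete.\<close>

locale edge_closed_set =
  fixes V :: "(real^3) set" and r t :: real and k :: nat
  assumes fin: "finite V"
    and connected: "\<lbrakk>W \<subseteq> V; W \<noteq> {}; \<And>w u. w \<in> W \<Longrightarrow> u \<in> V \<Longrightarrow> u \<bullet> w = t \<Longrightarrow> u \<in> W\<rbrakk> \<Longrightarrow> W = V"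
    and degree: "v \<in> V \<Longrightarrow> card {u \<in> V. u \<bullet> v = t} = k"
    and edge_sum: "v \<in> V \<Longrightarrow> \<Sum>{u \<in> V. u \<bullet> v = t} = (k * t / r) *\<^sub>R v"
    and edge_reflection: "\<lbrakk>v \<in> V; u \<in> V; u \<bullet> v = t; x \<in> V\<rbrakk> \<Longrightarrow> reflection (v - u) x \<in> V"
    and mirror: "\<lbrakk>odd k; v \<in> V; u \<in> V; u \<bullet> v = t; w \<in> V; w \<bullet> v = t; n \<bullet> v = 0; n \<bullet> u = 0\<rbrakk>
      \<Longrightarrow> reflection n w \<in> V"
    and antipode: "\<lbrakk>k = 4; v \<in> V; u \<in> V; u \<bullet> v = t\<rbrakk> \<Longrightarrow> (2 * t / r) *\<^sub>R v - u \<in> V"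

lemma (in homogeneous_sphere_set) edge_closed_image:
  assumes k: "\<And>v. v \<in> V \<Longrightarrow> card (N v) = k" and L: "orthogonal_transformation L" and r: "0 < r"
  shows "edge_closed_set ((\<lambda>x. sqrt r *\<^sub>R L x) ` V) r (r * t) k"
proof -
  define f where "f x = sqrt r *\<^sub>R L x" for x
  have ip: "f x \<bullet> f y = r * (x \<bullet> y)" for x y
    using r by (simp add: f_def orthogonal_transformation_inner[OF L])
  have ipt: "f x \<bullet> f y = r * t \<longleftrightarrow> x \<bullet> y = t" for x y using r by (simp add: ip)
  have inj: "inj f"
    using orthogonal_transformation_inj[OF L] r by (auto simp: inj_on_def f_def)
  have lin: "linear f"
    unfolding f_def using L by (intro linear_compose_scale_right orthogonal_transformation_linear)
  have nb: "{u \<in> f ` V. u \<bullet> f v = r * t} = f ` N v" for v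
    using r by (auto simp: N_def ip)
  have refl_f: "reflection (f e) (f x) = f (reflection e x)" for e x
    using r unfolding f_def
    by (simp add: reflection_scaleR reflection_conjugate[OF L]
        orthogonal_transformation_scaleR[OF orthogonal_transformation_reflection])
  have "edge_closed_set (f ` V) r (r * t) k"
  proof
    show "finite (f ` V)" using fin by simp
  next
    fix W assume W: "W \<subseteq> f ` V" "W \<noteq> {}"
      and closed: "\<And>w u. w \<in> W \<Longrightarrow> u \<in> f ` V \<Longrightarrow> u \<bullet> w = r * t \<Longrightarrow> u \<in> W"
    have "{x \<in> V. f x \<in> W} = V"
    proof (rule connected)
      show "{x \<in> V. f x \<in> W} \<noteq> {}" using W by auto
      show "N w \<subseteq> {x \<in> V. f x \<in> W}" if "w \<in> {x \<in> V. f x \<in> W}" for w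
        using closed[of "f w"] that by (auto simp: N_def ip)
    qed auto
    then show "W = f ` V" using W(1) by auto
  next
    fix v assume "v \<in> f ` V"
    then obtain x where x: "x \<in> V" "v = f x" by auto
    show "card {u \<in> f ` V. u \<bullet> v = r * t} = k"
      unfolding x(2) nb using k[OF x(1)] inj by (simp add: card_image inj_on_subset)
    have "\<Sum>(f ` N x) = f (\<Sum>(N x))"
      using inj by (simp add: linear_sum[OF lin] sum.reindex inj_on_subset[of f UNIV])
    then show "\<Sum>{u \<in> f ` V. u \<bullet> v = r * t} = (k * (r * t) / r) *\<^sub>R v"
      unfolding x(2) nb using sum_N[OF x(1)] k[OF x(1)] r by (simp add: linear_scale[OF lin])
  next
    fix v u x assume "v \<in> f ` V" "u \<in> f ` V" "u \<bullet> v = r * t" "x \<in> f ` V"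
    then obtain v' u' x' where *: "v' \<in> V" "u' \<in> N v'" "x' \<in> V" "v = f v'" "u = f u'" "x = f x'"
      by (auto simp: ipt N_def)
    have "reflection (v - u) x = f (reflection (v' - u') x')"
      by (simp add: * refl_f flip: linear_diff[OF lin])
    then show "reflection (v - u) x \<in> f ` V" using edge_reflection_V[OF *(1-3)] by simp
  next
    fix v u w n
    assume "odd k" "v \<in> f ` V" "u \<in> f ` V" "u \<bullet> v = r * t" "w \<in> f ` V" "w \<bullet> v = r * t"
      and n: "n \<bullet> v = 0" "n \<bullet> u = 0"
    then obtain v' u' w' where *: "v' \<in> V" "u' \<in> N v'" "w' \<in> N v'" "v = f v'" "u = f u'" "w = f w'"
      by (auto simp: ipt N_def)
    show "reflection n w \<in> f ` V"
    proof (cases "n = 0")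
      case True
      then show ?thesis using \<open>w \<in> f ` V\<close> by (simp add: reflection_def)
    next
      case False
      obtain m where "n = L m" using orthogonal_transformation_surj[OF L] by (metis surjD)
      then have m: "n = (1 / sqrt r) *\<^sub>R f m" using r by (simp add: f_def)
      have "m \<bullet> v' = 0" "m \<bullet> u' = 0" using n r unfolding m * by (auto simp: ip)
      then obtain c where c: "m = c *\<^sub>R (v' \<times> u')"
        using parallel_to_cross[OF cross_N_nonzero[OF *(1,2)]] by blast
      have "c \<noteq> 0" using c m False by (auto simp: linear_0[OF lin])
      then have "reflection m w' \<in> N v'"
        using N_mirror_odd[OF *(1) _ *(2,3)] k[OF *(1)] \<open>odd k\<close> by (simp add: c reflection_scaleR)
      moreover have "reflection n w = f (reflection m w')"
        using r by (simp add: m * reflection_scaleR refl_f)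
      ultimately show ?thesis by (simp add: N_def)
    qed
  next
    fix v u assume "k = 4" "v \<in> f ` V" "u \<in> f ` V" "u \<bullet> v = r * t"
    then obtain v' u' where *: "v' \<in> V" "u' \<in> N v'" "v = f v'" "u = f u'"
      by (auto simp: ipt N_def)
    have "(2 * (r * t) / r) *\<^sub>R v - u = f ((2 * t) *\<^sub>R v' - u')"
      using r by (simp add: * linear_diff[OF lin] linear_scale[OF lin])
    then show "(2 * (r * t) / r) *\<^sub>R v - u \<in> f ` V"
      using N_antipode[OF *(1) _ *(2)] k[OF *(1)] \<open>k = 4\<close> by (simp add: N_def)
  qed
  then show ?thesis by (simp add: f_def[abs_def])
qed

context edge_closed_set begin

text \<open>Every point of \<open>D\<close> already has all its neighbours in \<open>D\<close>.\<close>

lemma eq_if_saturated: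
  assumes "D \<subseteq> V" "D \<noteq> {}"
    and sat: "\<And>d. d \<in> D \<Longrightarrow> \<exists>M. M \<subseteq> D \<and> card M = k \<and> (\<forall>u\<in>M. u \<bullet> d = t)"
  shows "V = D"
proof (rule connected[OF assms(1,2), symmetric])
  fix d u assume d: "d \<in> D" and u: "u \<in> V" "u \<bullet> d = t"
  obtain M where M: "M \<subseteq> D" "card M = k" "\<forall>u\<in>M. u \<bullet> d = t" using sat[OF d] by auto
  have "M = {u \<in> V. u \<bullet> d = t}"
    by (rule card_subset_eq) (use fin M assms(1) degree[of d] d in auto)
  then show "u \<in> D" using u M(1) by blast
qed

lemma third_neighbour:
  assumes three: "k = 3" and v: "v \<in> V" and uw: "u \<in> V" "w \<in> V" "u \<noteq> w" "u \<bullet> v = t" "w \<bullet> v = t"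
  shows "(3 * t / r) *\<^sub>R v - u - w \<in> V"
proof -
  have "card ({u \<in> V. u \<bullet> v = t} - {u, w}) = 1"
    using degree[OF v] three uw fin by (simp add: card_Diff_subset)
  then obtain z where z: "{u \<in> V. u \<bullet> v = t} - {u, w} = {z}" by (auto simp: card_1_singleton_iff)
  then have "{u \<in> V. u \<bullet> v = t} = {u, w, z}" "z \<noteq> u" "z \<noteq> w" "z \<in> V" using uw by auto
  then have "u + (w + z) = (3 * t / r) *\<^sub>R v"
    using edge_sum[OF v] three uw(3) by simp
  then have "(3 * t / r) *\<^sub>R v - u - w = z" by (simp add: algebra_simps)
  then show ?thesis using \<open>z \<in> V\<close> by simp
qed

end

section \<open>Coordinates of the six polyhedra\<close>

lemma vec3_simps:
  fixes a b c a' b' c' s :: real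
  shows "(vector [a, b, c] :: real^3) + vector [a', b', c'] = vector [a + a', b + b', c + c']"
    "(vector [a, b, c] :: real^3) - vector [a', b', c'] = vector [a - a', b - b', c - c']"
    "- (vector [a, b, c] :: real^3) = vector [- a, - b, - c]"
    "s *\<^sub>R (vector [a, b, c] :: real^3) = vector [s * a, s * b, s * c]"
    "(vector [a, b, c] :: real^3) \<bullet> vector [a', b', c'] = a * a' + b * b' + c * c'"
    "(vector [a, b, c] :: real^3) = vector [a', b', c'] \<longleftrightarrow> a = a' \<and> b = b' \<and> c = c'"
  by (auto simp: vec_eq_iff forall_3 inner_vec_def sum_3)

lemma reflection_axes:
  fixes s x y z :: real
  assumes "s \<noteq> 0"
  shows "reflection (vector [s, 0, 0]) (vector [x, y, z] :: real^3) = vector [- x, y, z]"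
    "reflection (vector [0, s, 0]) (vector [x, y, z] :: real^3) = vector [x, - y, z]"
    "reflection (vector [0, 0, s]) (vector [x, y, z] :: real^3) = vector [x, y, - z]"
  using assms by (simp_all add: reflection_def vec3_simps)

lemma all_signs:
  fixes V :: "(real^3) set"
  assumes flip: "\<And>x y z. vector [x, y, z] \<in> V \<Longrightarrow> vector [- x, y, z] \<in> V"
    "\<And>x y z. vector [x, y, z] \<in> V \<Longrightarrow> vector [x, - y, z] \<in> V"
    "\<And>x y z. vector [x, y, z] \<in> V \<Longrightarrow> vector [x, y, - z] \<in> V"
    and p: "vector [x, y, z] \<in> V" and "a \<in> {-1, 1}" "b \<in> {-1, 1}" "c \<in> {-1, 1}"
  shows "vector [a * x, b * y, c * z] \<in> V"
proof -
  have "vector [a * x, y, z] \<in> V" using flip(1)[OF p] p assms(5) by auto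
  then have "vector [a * x, b * y, z] \<in> V" using flip(2) assms(6) by auto
  then show ?thesis using flip(3) assms(7) by auto
qed

lemma (in edge_closed_set) eq_tetrahedron_vertices:
  assumes [simp]: "r = 3" "t = -1" "k = 3"
    and V: "vector [1, 1, 1] \<in> V" "vector [1, -1, -1] \<in> V" "vector [-1, 1, -1] \<in> V"
  shows "V = {vector [1, 1, 1], vector [1, -1, -1], vector [-1, 1, -1], vector [-1, -1, 1]}"
    (is "V = ?D")
proof (rule eq_if_saturated)
  have "vector [-1, -1, 1] \<in> V"
    using third_neighbour[OF _ V] by (simp add: vec3_simps)
  then show "?D \<subseteq> V" using V by simp
  fix d assume "d \<in> ?D"
  then show "\<exists>M. M \<subseteq> ?D \<and> card M = k \<and> (\<forall>u\<in>M. u \<bullet> d = t)"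
    by (intro exI[of _ "?D - {d}"]) (auto simp: vec3_simps card_insert_if)
qed simp

text \<open>Three edges at one vertex are parallel to the axes, so the reflections in them change signs of coordinates.\<close>

lemma (in edge_closed_set) eq_cube_vertices:
  assumes [simp]: "r = 3" "t = 1" "k = 3"
    and V: "vector [1, 1, 1] \<in> V" "vector [-1, 1, 1] \<in> V" "vector [1, -1, 1] \<in> V"
  shows "V = {vector [x, y, z] | x y z. x \<in> {-1, 1} \<and> y \<in> {-1, 1} \<and> z \<in> {-1, 1}}"
    (is "V = ?D")
proof (rule eq_if_saturated)
  have 3: "vector [1, 1, -1] \<in> V"
    using third_neighbour[OF _ V] by (simp add: vec3_simps)
  have flip: "vector [- x, y, z] \<in> V" "vector [x, - y, z] \<in> V" "vector [x, y, - z] \<in> V"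
    if "vector [x, y, z] \<in> V" for x y z
    using edge_reflection[OF V(1,2) _ that] edge_reflection[OF V(1,3) _ that]
      edge_reflection[OF V(1) 3 _ that]
    by (simp_all add: vec3_simps reflection_axes)
  show "?D \<subseteq> V" using all_signs[OF flip V(1)] by auto
  show "?D \<noteq> {}" by blast
  fix d assume "d \<in> ?D"
  then obtain x y z where d: "d = vector [x, y, z]" "x \<in> {-1, 1}" "y \<in> {-1, 1}" "z \<in> {-1, 1}"
    by blast
  show "\<exists>M. M \<subseteq> ?D \<and> card M = k \<and> (\<forall>u\<in>M. u \<bullet> d = t)"
    using d by (intro exI[of _ "{vector [- x, y, z], vector [x, - y, z], vector [x, y, - z]}"])
      (auto simp: vec3_simps card_insert_if)
qed

lemma (in edge_closed_set) eq_octahedron_vertices: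
  assumes [simp]: "r = 1" "t = 0" "k = 4"
    and V: "vector [1, 0, 0] \<in> V" "vector [0, 1, 0] \<in> V" "vector [0, 0, 1] \<in> V"
  shows "V = (\<Union>s\<in>{-1, 1}. {vector [s, 0, 0], vector [0, s, 0], vector [0, 0, s]})" (is "V = ?D")
proof (rule eq_if_saturated)
  have "vector [-1, 0, 0] \<in> V" "vector [0, -1, 0] \<in> V" "vector [0, 0, -1] \<in> V"
    using antipode[OF _ V(2,1)] antipode[OF _ V(1,2)] antipode[OF _ V(1,3)]
    by (simp_all add: vec3_simps)
  then show "?D \<subseteq> V" using V by simp
  fix d assume "d \<in> ?D"
  then show "\<exists>M. M \<subseteq> ?D \<and> card M = k \<and> (\<forall>u\<in>M. u \<bullet> d = t)"
    by (intro exI[of _ "?D - {d, - d}"]) (auto simp: vec3_simps card_insert_if)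
qed simp

text \<open>As \<open>2 * t / r = 1\<close>, a neighbour \<open>u\<close> of \<open>v\<close> has the opposite neighbour \<open>v - u\<close>. So \<open>V\<close>
contains the differences and the negatives of the three given vectors: it is a root system of type A3.\<close>

lemma (in edge_closed_set) eq_cuboctahedron_vertices:
  assumes [simp]: "r = 2" "t = 1" "k = 4"
    and V: "vector [1, 1, 0] \<in> V" "vector [1, 0, 1] \<in> V" "vector [0, 1, 1] \<in> V"
  shows "V = (\<Union>x\<in>{-1, 1}. \<Union>y\<in>{-1, 1}. {vector [x, y, 0], vector [x, 0, y], vector [0, x, y]})"
    (is "V = ?D")
proof (rule eq_if_saturated)
  have diff: "v - u \<in> V" "- u \<in> V" if "v \<in> V" "u \<in> V" "u \<bullet> v = 1" "v \<bullet> v = 2" for u v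
  proof -
    show vu: "v - u \<in> V" using antipode[of v u] that by simp
    then have "(v - u) - v \<in> V" using antipode[of "v - u" v] that
      by (simp add: inner_diff_right inner_diff_left inner_commute)
    then show "- u \<in> V" by simp
  qed
  have "vector [-1, -1, 0] \<in> V" "vector [-1, 0, -1] \<in> V" "vector [0, -1, -1] \<in> V"
    "vector [0, 1, -1] \<in> V" "vector [1, 0, -1] \<in> V" "vector [1, -1, 0] \<in> V"
    "vector [0, -1, 1] \<in> V" "vector [-1, 0, 1] \<in> V" "vector [-1, 1, 0] \<in> V"
    using diff(2)[OF V(2,1)] diff(2)[OF V(1,2)] diff(2)[OF V(1,3)] diff(1)[OF V(1,2)]
      diff(1)[OF V(1,3)] diff(1)[OF V(2,3)] diff(1)[OF V(2,1)] diff(1)[OF V(3,1)] diff(1)[OF V(3,2)]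
    by (simp_all add: vec3_simps)
  then show "?D \<subseteq> V" using V by simp
  fix d assume "d \<in> ?D"
  then obtain x y where xy: "x \<in> {-1, 1}" "y \<in> {-1, 1}"
    and d: "d = vector [x, y, 0] \<or> d = vector [x, 0, y] \<or> d = vector [0, x, y]"
    by blast
  from d show "\<exists>M. M \<subseteq> ?D \<and> card M = k \<and> (\<forall>u\<in>M. u \<bullet> d = t)"
  proof (elim disjE)
    assume d: "d = vector [x, y, 0]"
    show ?thesis using xy unfolding d
      by (intro exI[of _ "{vector [x, 0, 1], vector [x, 0, -1], vector [0, y, 1], vector [0, y, -1]}"])
        (auto simp: vec3_simps card_insert_if)
  next
    assume d: "d = vector [x, 0, y]"
    show ?thesis using xy unfolding d
      by (intro exI[of _ "{vector [x, 1, 0], vector [x, -1, 0], vector [0, 1, y], vector [0, -1, y]}"])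
        (auto simp: vec3_simps card_insert_if)
  next
    assume d: "d = vector [0, x, y]"
    show ?thesis using xy unfolding d
      by (intro exI[of _ "{vector [1, x, 0], vector [-1, x, 0], vector [1, 0, y], vector [-1, 0, y]}"])
        (auto simp: vec3_simps card_insert_if)
  qed
qed simp

text \<open>The mirror symmetries of the neighbours of a vertex give, for each axis, an edge parallel to it; the
reflections in these edges change signs of coordinates.\<close>

lemma (in edge_closed_set) eq_icosahedron_vertices:
  assumes [simp]: "r = golden_ratio + 2" "t = golden_ratio" "k = 5"
    and V: "vector [0, 1, golden_ratio] \<in> V" "vector [1, golden_ratio, 0] \<in> V"
      "vector [golden_ratio, 0, 1] \<in> V"
  shows "V = (\<Union>s\<in>{-1, 1}. \<Union>t\<in>{-1, 1}. {vector [0, s, t * golden_ratio],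
    vector [s, t * golden_ratio, 0], vector [t * golden_ratio, 0, s]})" (is "V = ?D")
proof (rule eq_if_saturated)
  let ?g = golden_ratio
  note gs = golden_ratio_square golden_ratio_square_left
  have refl: "reflection n w = w - n" if "2 * (w \<bullet> n) = n \<bullet> n" "n \<bullet> n \<noteq> 0" for n w :: "real^3"
    using that by (simp add: reflection_def)
  have 1: "vector [0, -1, ?g] \<in> V"
    using mirror[OF _ V(1,3) _ V(2), of "vector [1, ?g + 1, - ?g]"] golden_ratio_bounds
    by (simp add: vec3_simps algebra_simps gs refl)
  have 2: "vector [-1, ?g, 0] \<in> V"
    using mirror[OF _ V(1,2) _ V(3), of "vector [?g + 1, - ?g, 1]"] golden_ratio_bounds
    by (simp add: vec3_simps algebra_simps gs refl)
  have 3: "vector [?g, 0, -1] \<in> V"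
    using mirror[OF _ V(3,2) _ V(1), of "vector [- ?g, 1, ?g + 1]"] golden_ratio_bounds
    by (simp add: vec3_simps algebra_simps gs refl)
  have flip: "vector [- x, y, z] \<in> V" "vector [x, - y, z] \<in> V" "vector [x, y, - z] \<in> V"
    if "vector [x, y, z] \<in> V" for x y z
    using edge_reflection[OF V(2) 2 _ that] edge_reflection[OF V(1) 1 _ that]
      edge_reflection[OF V(3) 3 _ that]
    by (simp_all add: vec3_simps reflection_axes gs)
  have mem: "vector [0, s, t * ?g] \<in> V" "vector [s, t * ?g, 0] \<in> V" "vector [t * ?g, 0, s] \<in> V"
    if "s \<in> {-1, 1}" "t \<in> {-1, 1}" for s t :: real
    using all_signs[OF flip V(1), of 1 s t] all_signs[OF flip V(2), of s t 1]
      all_signs[OF flip V(3), of t 1 s] that by auto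
  show "?D \<subseteq> V" using mem by blast
  fix d assume "d \<in> ?D"
  then obtain s t' where st: "s \<in> {-1, 1}" "t' \<in> {-1, 1}"
    and d: "d = vector [0, s, t' * ?g] \<or> d = vector [s, t' * ?g, 0] \<or> d = vector [t' * ?g, 0, s]"
    by blast
  from d show "\<exists>M. M \<subseteq> ?D \<and> card M = k \<and> (\<forall>u\<in>M. u \<bullet> d = t)"
  proof (elim disjE)
    assume d: "d = vector [0, s, t' * ?g]"
    show ?thesis using st golden_ratio_bounds unfolding d
      by (intro exI[of _ "{vector [0, - s, t' * ?g], vector [1, s * ?g, 0], vector [-1, s * ?g, 0],
          vector [?g, 0, t'], vector [- ?g, 0, t']}"])
        (auto simp: vec3_simps card_insert_if gs)
  next
    assume d: "d = vector [s, t' * ?g, 0]"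
    show ?thesis using st golden_ratio_bounds unfolding d
      by (intro exI[of _ "{vector [- s, t' * ?g, 0], vector [0, t', ?g], vector [0, t', - ?g],
          vector [s * ?g, 0, 1], vector [s * ?g, 0, -1]}"])
        (auto simp: vec3_simps card_insert_if gs)
  next
    assume d: "d = vector [t' * ?g, 0, s]"
    show ?thesis using st golden_ratio_bounds unfolding d
      by (intro exI[of _ "{vector [t' * ?g, 0, - s], vector [0, 1, s * ?g], vector [0, -1, s * ?g],
          vector [t', ?g, 0], vector [t', - ?g, 0]}"])
        (auto simp: vec3_simps card_insert_if gs)
  qed
qed simp

text \<open>Reflections in the edges at the vertex \<open>vector [1, 1, 1]\<close> give, for each axis, an edge parallel to it; the reflections
in these change signs of coordinates.\<close>

lemma (in edge_closed_set) eq_dodecahedron_vertices: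
  assumes [simp]: "r = 3" "t = 2 * golden_ratio - 1" "k = 3"
    and V: "vector [1, 1, 1] \<in> V" "vector [0, 1 / golden_ratio, golden_ratio] \<in> V"
      "vector [1 / golden_ratio, golden_ratio, 0] \<in> V"
  shows "V = {vector [x, y, z] | x y z. x \<in> {-1, 1} \<and> y \<in> {-1, 1} \<and> z \<in> {-1, 1}} \<union>
      (\<Union>s\<in>{-1, 1}. \<Union>t\<in>{-1, 1}.
         {vector [0, s / golden_ratio, t * golden_ratio],
          vector [s / golden_ratio, t * golden_ratio, 0],
          vector [t * golden_ratio, 0, s / golden_ratio]})" (is "V = ?C \<union> ?D")
proof (rule eq_if_saturated)
  let ?g = golden_ratio and ?h = "golden_ratio - 1"
  note gs = golden_ratio_square golden_ratio_square_left
  note V = V[unfolded inverse_golden_ratio mult_1]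
  have c: "3 * t / r = 2 * ?g - 1" by simp
  have V4: "vector [?g, 0, ?h] \<in> V"
    using third_neighbour[unfolded c, OF _ V] by (simp add: vec3_simps algebra_simps gs)
  have edge: "w + ?g *\<^sub>R (u - v) \<in> V"
    if "v \<in> V" "u \<in> V" "w \<in> V" "u \<bullet> v = t" "v \<bullet> v = 3" "u \<bullet> u = 3" "w \<bullet> v = t" "w \<bullet> u = 1" for u v w
  proof -
    have "(v - u) \<bullet> (v - u) = 4 * (2 - ?g)" "w \<bullet> (v - u) = 2 * ?h"
      using that by (simp_all add: inner_diff_left inner_diff_right inner_commute)
    then have "2 * (w \<bullet> (v - u)) / ((v - u) \<bullet> (v - u)) = 4 * ?h / (4 * (2 - ?g))" by simp
    also have "\<dots> = ?g" using golden_ratio_bounds by (simp add: field_simps gs)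
    finally have "reflection (v - u) w = w - ?g *\<^sub>R (v - u)" by (simp only: reflection_def)
    also have "w - ?g *\<^sub>R (v - u) = w + ?g *\<^sub>R (u - v)" by (simp add: algebra_simps)
    finally show ?thesis using edge_reflection[OF that(1,2,4,3)] by (simp only:)
  qed
  have 1: "vector [0, - ?h, ?g] \<in> V"
    using edge[OF V(1,2) V4] by (simp add: vec3_simps algebra_simps gs)
  have 2: "vector [- ?h, ?g, 0] \<in> V"
    using edge[OF V(1,3,2)] by (simp add: vec3_simps algebra_simps gs)
  have 3: "vector [?g, 0, - ?h] \<in> V"
    using edge[OF V(1) V4 V(3)] by (simp add: vec3_simps algebra_simps gs)
  have flip: "vector [- x, y, z] \<in> V" "vector [x, - y, z] \<in> V" "vector [x, y, - z] \<in> V"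
    if "vector [x, y, z] \<in> V" for x y z
    using edge_reflection[OF V(3) 2 _ that] edge_reflection[OF V(2) 1 _ that]
      edge_reflection[OF V4 3 _ that] golden_ratio_bounds
    by (simp_all add: vec3_simps reflection_axes algebra_simps gs)
  have mem: "vector [0, s / ?g, t * ?g] \<in> V" "vector [s / ?g, t * ?g, 0] \<in> V" "vector [t * ?g, 0, s / ?g] \<in> V"
    if "s \<in> {-1, 1}" "t \<in> {-1, 1}" for s t :: real
    using all_signs[OF flip V(2), of 1 s t] all_signs[OF flip V(3), of s t 1]
      all_signs[OF flip V4, of t 1 s] that by (auto simp: inverse_golden_ratio)
  have "?D \<subseteq> V" using mem by blast
  moreover have "?C \<subseteq> V" using all_signs[OF flip V(1)] by auto
  ultimately show "?C \<union> ?D \<subseteq> V" by simp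
  show "?C \<union> ?D \<noteq> {}" by simp
  have memC: "vector [x, y, z] \<in> ?C \<union> ?D"
    if "x \<in> {-1, 1}" "y \<in> {-1, 1}" "z \<in> {-1, 1}" for x y z :: real
    using that by blast
  have memD: "vector [0, s / ?g, t' * ?g] \<in> ?C \<union> ?D" "vector [s / ?g, t' * ?g, 0] \<in> ?C \<union> ?D"
    "vector [t' * ?g, 0, s / ?g] \<in> ?C \<union> ?D"
    if "s \<in> {-1, 1}" "t' \<in> {-1, 1}" for s t' :: real
    using that by blast+
  fix d assume "d \<in> ?C \<union> ?D"
  then consider x y z where "d = vector [x, y, z]" "x \<in> {-1, 1}" "y \<in> {-1, 1}" "z \<in> {-1, 1}"
    | s t' where "s \<in> {-1, 1}" "t' \<in> {-1, 1}"
      "d = vector [0, s / ?g, t' * ?g] \<or> d = vector [s / ?g, t' * ?g, 0] \<or> d = vector [t' * ?g, 0, s / ?g]"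
    by blast
  then show "\<exists>M. M \<subseteq> ?C \<union> ?D \<and> card M = k \<and> (\<forall>u\<in>M. u \<bullet> d = t)"
  proof cases
    case (1 x y z)
    let ?M = "{vector [0, y / ?g, z * ?g], vector [x / ?g, y * ?g, 0], vector [x * ?g, 0, z / ?g]} :: (real^3) set"
    have "?M \<subseteq> ?C \<union> ?D" using memD[of y z] memD[of x y] memD[of z x] 1 by simp
    moreover have "card ?M = k" "\<forall>u\<in>?M. u \<bullet> d = t"
      using 1 golden_ratio_bounds
      by (auto simp: vec3_simps card_insert_if inverse_golden_ratio algebra_simps gs)
    ultimately show ?thesis by blast
  next
    case (2 s t')
    have ms: "- s \<in> {-1, 1}" using 2(1) by auto
    from 2(3) show ?thesis
    proof (elim disjE)
      assume d: "d = vector [0, s / ?g, t' * ?g]"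
      let ?M = "{vector [1, s, t'], vector [-1, s, t'], vector [0, (- s) / ?g, t' * ?g]} :: (real^3) set"
      have "?M \<subseteq> ?C \<union> ?D" using memC[of 1 s t'] memC[of "-1" s t'] memD(1)[OF ms 2(2)] 2 by simp
      moreover have "card ?M = k" "\<forall>u\<in>?M. u \<bullet> d = t"
        using 2(1,2) golden_ratio_bounds unfolding d
        by (auto simp: vec3_simps card_insert_if inverse_golden_ratio algebra_simps gs)
      ultimately show ?thesis by blast
    next
      assume d: "d = vector [s / ?g, t' * ?g, 0]"
      let ?M = "{vector [s, t', 1], vector [s, t', -1], vector [(- s) / ?g, t' * ?g, 0]} :: (real^3) set"
      have "?M \<subseteq> ?C \<union> ?D" using memC[of s t' 1] memC[of s t' "-1"] memD(2)[OF ms 2(2)] 2 by simp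
      moreover have "card ?M = k" "\<forall>u\<in>?M. u \<bullet> d = t"
        using 2(1,2) golden_ratio_bounds unfolding d
        by (auto simp: vec3_simps card_insert_if inverse_golden_ratio algebra_simps gs)
      ultimately show ?thesis by blast
    next
      assume d: "d = vector [t' * ?g, 0, s / ?g]"
      let ?M = "{vector [t', 1, s], vector [t', -1, s], vector [t' * ?g, 0, (- s) / ?g]} :: (real^3) set"
      have "?M \<subseteq> ?C \<union> ?D" using memC[of t' 1 s] memC[of t' "-1" s] memD(3)[OF ms 2(2)] 2 by simp
      moreover have "card ?M = k" "\<forall>u\<in>?M. u \<bullet> d = t"
        using 2(1,2) golden_ratio_bounds unfolding d
        by (auto simp: vec3_simps card_insert_if inverse_golden_ratio algebra_simps gs)
      ultimately show ?thesis by blast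
    qed
  qed
qed

section \<open>The cuboctahedron and the edges of the cube\<close>

lemma cube_edge:
  assumes "a \<in> {-1, 1}" "b \<in> {-1, 1}"
  shows "closed_segment (vector [-1, a, b]) (vector [1, a, b]) edge_of cube"
    "closed_segment (vector [a, -1, b]) (vector [a, 1, b]) edge_of cube"
    "closed_segment (vector [a, b, -1]) (vector [a, b, 1]) edge_of cube"
proof -
  let ?C = "{vector [x, y, z] | x y z. x \<in> {-1, 1} \<and> y \<in> {-1, 1} \<and> z \<in> {-1, 1}} :: (real^3) set"
  have C: "?C = (\<Union>x\<in>{-1, 1}. \<Union>y\<in>{-1, 1}. \<Union>z\<in>{-1, 1}. {vector [x, y, z]})" by blast
  have fin: "finite ?C" unfolding C by simp
  have "exposed_pair ?C (vector [-1, a, b]) (vector [1, a, b])"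
    unfolding exposed_pair_def using assms
    by (intro conjI exI[of _ "vector [0, a, b]"] exI[of _ 2]) (auto simp: vec3_simps)
  then show "closed_segment (vector [-1, a, b]) (vector [1, a, b]) edge_of cube"
    unfolding cube_def by (rule exposed_pair_edge_of[OF fin])
  have "exposed_pair ?C (vector [a, -1, b]) (vector [a, 1, b])"
    unfolding exposed_pair_def using assms
    by (intro conjI exI[of _ "vector [a, 0, b]"] exI[of _ 2]) (auto simp: vec3_simps)
  then show "closed_segment (vector [a, -1, b]) (vector [a, 1, b]) edge_of cube"
    unfolding cube_def by (rule exposed_pair_edge_of[OF fin])
  have "exposed_pair ?C (vector [a, b, -1]) (vector [a, b, 1])"
    unfolding exposed_pair_def using assms
    by (intro conjI exI[of _ "vector [a, b, 0]"] exI[of _ 2]) (auto simp: vec3_simps)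
  then show "closed_segment (vector [a, b, -1]) (vector [a, b, 1]) edge_of cube"
    unfolding cube_def by (rule exposed_pair_edge_of[OF fin])
qed

lemma cube_vertex_iff:
  "p \<in> {vector [x, y, z] | x y z. x \<in> {-1, 1} \<and> y \<in> {-1, 1} \<and> z \<in> {-1, 1}}
    \<longleftrightarrow> (\<forall>i. p $ i \<in> {-1, 1})" for p :: "real^3"
proof
  assume "\<forall>i. p $ i \<in> {-1, 1}"
  moreover have "p = vector [p $ 1, p $ 2, p $ 3]" by (simp add: vec_eq_iff forall_3)
  ultimately show "p \<in> {vector [x, y, z] | x y z. x \<in> {-1, 1} \<and> y \<in> {-1, 1} \<and> z \<in> {-1, 1}}"
    by blast
qed (auto simp: forall_3)

text \<open>If the ends of an edge differed in two coordinates, exchanging one of these would give another segment in the cube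
with the same midpoint, which contradicts that the edge is a face.\<close>

lemma cube_edge_endpoints:
  assumes edge: "closed_segment a b edge_of cube"
  shows "a $ i \<in> {-1, 1}" "b $ i \<in> {-1, 1}" "a \<noteq> b" "a $ i \<noteq> b $ i \<Longrightarrow> a $ j \<noteq> b $ j \<Longrightarrow> i = j"
proof -
  have face: "closed_segment a b face_of cube" and dim: "aff_dim (closed_segment a b) = 1"
    using edge by (auto simp: edge_of_def)
  show "a \<noteq> b" using dim by (auto simp: aff_dim_sing)
  have "a extreme_point_of cube" "b extreme_point_of cube"
    using extreme_point_of_face[OF face, of a] extreme_point_of_face[OF face, of b]
    by (auto simp: extreme_point_of_segment)
  then have C: "(\<forall>i. a $ i \<in> {-1, 1}) \<and> (\<forall>i. b $ i \<in> {-1, 1})"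
    unfolding cube_def cube_vertex_iff[symmetric] by (intro conjI extreme_point_of_convex_hull)
  then show "a $ i \<in> {-1, 1}" "b $ i \<in> {-1, 1}" by auto
  show "i = j" if ij: "a $ i \<noteq> b $ i" "a $ j \<noteq> b $ j"
  proof (rule ccontr)
    assume "i \<noteq> j"
    define a' where "a' = (\<chi> l. if l = i then b $ l else a $ l)"
    define b' where "b' = (\<chi> l. if l = i then a $ l else b $ l)"
    have "\<forall>l. a' $ l \<in> {-1, 1}" "\<forall>l. b' $ l \<in> {-1, 1}" using C by (simp_all add: a'_def b'_def)
    then have "a' \<in> cube" "b' \<in> cube"
      unfolding cube_def cube_vertex_iff[symmetric] by - (rule hull_inc, assumption)+
    moreover have "midpoint a' b' = midpoint a b"
      by (auto simp: vec_eq_iff midpoint_def a'_def b'_def)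
    moreover have "a' \<noteq> b'" using ij by (auto simp: vec_eq_iff a'_def b'_def)
    then have "midpoint a' b' \<in> open_segment a' b'" by (rule midpoint_in_open_segment[THEN iffD2])
    moreover have "midpoint a b \<in> closed_segment a b" by (rule midpoint_in_closed_segment)
    ultimately have "a' \<in> closed_segment a b" using face unfolding face_of_def by metis
    then obtain c where c: "a' = (1 - c) *\<^sub>R a + c *\<^sub>R b" by (auto simp: in_segment)
    have "b $ i = (1 - c) * a $ i + c * b $ i" "a $ j = (1 - c) * a $ j + c * b $ j"
      using arg_cong[OF c, of "\<lambda>p. p $ i"] arg_cong[OF c, of "\<lambda>p. p $ j"] \<open>i \<noteq> j\<close>
      by (auto simp: a'_def)
    then have "(1 - c) * (b $ i - a $ i) = 0" "c * (b $ j - a $ j) = 0"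
      by (auto simp: algebra_simps)
    then show False using ij by simp
  qed
qed

lemma cuboctahedron_eq:
  "cuboctahedron = convex hull
    (\<Union>x\<in>{-1, 1}. \<Union>y\<in>{-1, 1}. {vector [x, y, 0], vector [x, 0, y], vector [0, x, y]})"
proof -
  let ?M = "{midpoint a b | a b. closed_segment a b edge_of cube}"
  let ?D = "(\<Union>x\<in>{-1, 1}. \<Union>y\<in>{-1, 1}. {vector [x, y, 0], vector [x, 0, y], vector [0, x, y]})
    :: (real^3) set"
  have "?M \<subseteq> ?D"
  proof
    fix m assume "m \<in> ?M"
    then obtain a b where m: "m = midpoint a b" and e: "closed_segment a b edge_of cube" by auto
    note ends = cube_edge_endpoints[OF e]
    have diff: "a $ 1 \<noteq> b $ 1 \<or> a $ 2 \<noteq> b $ 2 \<or> a $ 3 \<noteq> b $ 3"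
      using ends(3) by (auto simp: vec_eq_iff forall_3)
    have zero: "a $ i + b $ i = 0" if "a $ i \<noteq> b $ i" for i
      using ends(1,2)[of i] that by auto
    have same: "a $ j = b $ j" if "a $ i \<noteq> b $ i" "i \<noteq> j" for i j
      using ends(4)[of i j] that by blast
    have mi: "m = vector [(a $ 1 + b $ 1) / 2, (a $ 2 + b $ 2) / 2, (a $ 3 + b $ 3) / 2]"
      by (simp add: m midpoint_def vec_eq_iff forall_3 field_simps)
    from diff consider "m = vector [0, a $ 2, a $ 3]" | "m = vector [a $ 1, 0, a $ 3]"
      | "m = vector [a $ 1, a $ 2, 0]"
    proof (elim disjE)
      assume "a $ 1 \<noteq> b $ 1"
      then show ?thesis using that(1) mi zero[of 1] same[of 1 2] same[of 1 3] by simp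
    next
      assume "a $ 2 \<noteq> b $ 2"
      then show ?thesis using that(2) mi zero[of 2] same[of 2 1] same[of 2 3] by simp
    next
      assume "a $ 3 \<noteq> b $ 3"
      then show ?thesis using that(3) mi zero[of 3] same[of 3 1] same[of 3 2] by simp
    qed
    then show "m \<in> ?D" using ends(1)[of 1] ends(1)[of 2] ends(1)[of 3] by cases blast+
  qed
  moreover have mids: "vector [x, y, 0] \<in> ?M" "vector [x, 0, y] \<in> ?M" "vector [0, x, y] \<in> ?M"
    if "x \<in> {-1, 1}" "y \<in> {-1, 1}" for x y
  proof -
    have "vector [x, y, 0] = midpoint (vector [x, y, -1]) (vector [x, y, 1] :: real^3)"
      "vector [x, 0, y] = midpoint (vector [x, -1, y]) (vector [x, 1, y] :: real^3)"
      "vector [0, x, y] = midpoint (vector [-1, x, y]) (vector [1, x, y] :: real^3)"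
      by (simp_all add: midpoint_def vec3_simps)
    then show "vector [x, y, 0] \<in> ?M" "vector [x, 0, y] \<in> ?M" "vector [0, x, y] \<in> ?M"
      using cube_edge[OF that] by blast+
  qed
  have "?D \<subseteq> ?M"
  proof (intro UN_least)
    fix x y :: real assume "x \<in> {-1, 1}" "y \<in> {-1, 1}"
    then show "{vector [x, y, 0], vector [x, 0, y], vector [0, x, y]} \<subseteq> ?M"
      using mids[of x y] by (simp only: insert_subset empty_subsetI simp_thms)
  qed
  ultimately have "?M = ?D" by blast
  then show ?thesis by (simp only: cuboctahedron_def)
qed

section \<open>The classification\<close>

text \<open>The radius of each model is the square root of \<open>r\<close>; the three points \<open>a\<close>, \<open>b\<close>, \<open>c\<close> of the model have, up
to the factor \<open>r\<close>, the inner products of \<open>v\<close> and two of its neighbours.\<close>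

lemma (in homogeneous_sphere_set) hull_is_listed_polyhedron:
  "\<exists>L r. orthogonal_transformation L \<and> 0 < r \<and> convex hull ((\<lambda>x. sqrt r *\<^sub>R L x) ` V)
    \<in> {tetrahedron, cube, octahedron, dodecahedron, icosahedron, cuboctahedron}"
proof -
  let ?g = golden_ratio
  obtain v where v: "v \<in> V" using ex_V by auto
  define k where "k = card (N v)"
  have k: "card (N x) = k" if "x \<in> V" for x using card_N_eq[OF that v] by (simp add: k_def)
  have place: "\<exists>L. orthogonal_transformation L \<and> edge_closed_set ((\<lambda>x. sqrt r *\<^sub>R L x) ` V) r (r * t) k
      \<and> a \<in> (\<lambda>x. sqrt r *\<^sub>R L x) ` V \<and> b \<in> (\<lambda>x. sqrt r *\<^sub>R L x) ` V \<and> c \<in> (\<lambda>x. sqrt r *\<^sub>R L x) ` V"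
    if uw: "u \<in> N v" "w \<in> N v" "w \<bullet> (v \<times> u) \<noteq> 0" and r: "0 < r"
      and gram: "a \<bullet> a = r" "b \<bullet> b = r" "c \<bullet> c = r" "a \<bullet> b = r * t" "a \<bullet> c = r * t"
        "b \<bullet> c = r * (w \<bullet> u)" for u w r and a b c :: "real^3"
  proof -
    have "\<exists>L. orthogonal_transformation L \<and> sqrt r *\<^sub>R L v = a \<and> sqrt r *\<^sub>R L u = b \<and> sqrt r *\<^sub>R L w = c"
      by (rule align_triple[OF uw(3) r])
        (use gram uw v unit in \<open>simp_all add: in_N inner_commute\<close>)
    then obtain L where L: "orthogonal_transformation L"
      "sqrt r *\<^sub>R L v = a" "sqrt r *\<^sub>R L u = b" "sqrt r *\<^sub>R L w = c" by auto
    then show ?thesis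
      using edge_closed_image[OF k L(1) r] v uw by (intro exI[of _ L]) (auto simp: in_N)
  qed
  have "k \<in> {3, 4, 5}" using card_N_ge_3[OF v] card_N_le_5[OF v] by (auto simp: k_def)
  then consider "k = 3" | "k = 4" | "k = 5" by auto
  then show ?thesis
  proof cases
    case 1
    obtain u w where uw: "u \<in> N v" "w \<in> N v" "w \<bullet> u = (3 * t\<^sup>2 - 1) / 2" "w \<bullet> (v \<times> u) \<noteq> 0"
      and t: "t = -1/3 \<or> t = 1/3 \<or> t = (2 * ?g - 1) / 3"
      using three_cases[OF v] k[OF v] 1 by auto
    note place = place[OF uw(1,2,4), of 3]
    from t show ?thesis
    proof (elim disjE)
      assume t: "t = -1/3"
      have "w \<bullet> u = -1/3" using uw(3) unfolding t by (simp add: power2_eq_square)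
      then obtain L where L: "orthogonal_transformation L"
        "edge_closed_set ((\<lambda>x. sqrt 3 *\<^sub>R L x) ` V) 3 (-1) 3"
        "vector [1, 1, 1] \<in> (\<lambda>x. sqrt 3 *\<^sub>R L x) ` V"
        "vector [1, -1, -1] \<in> (\<lambda>x. sqrt 3 *\<^sub>R L x) ` V"
        "vector [-1, 1, -1] \<in> (\<lambda>x. sqrt 3 *\<^sub>R L x) ` V"
        using place[of "vector [1, 1, 1]" "vector [1, -1, -1]" "vector [-1, 1, -1]"] t 1
        by (auto simp: vec3_simps)
      have "convex hull ((\<lambda>x. sqrt 3 *\<^sub>R L x) ` V) = tetrahedron"
        using edge_closed_set.eq_tetrahedron_vertices[OF L(2) HOL.refl HOL.refl HOL.refl L(3-5)]
        by (simp only: tetrahedron_def)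
      then show ?thesis using L(1) by (intro exI[of _ L] exI[of _ 3]) simp
    next
      assume t: "t = 1/3"
      have "w \<bullet> u = -1/3" using uw(3) unfolding t by (simp add: power2_eq_square)
      then obtain L where L: "orthogonal_transformation L"
        "edge_closed_set ((\<lambda>x. sqrt 3 *\<^sub>R L x) ` V) 3 1 3"
        "vector [1, 1, 1] \<in> (\<lambda>x. sqrt 3 *\<^sub>R L x) ` V"
        "vector [-1, 1, 1] \<in> (\<lambda>x. sqrt 3 *\<^sub>R L x) ` V"
        "vector [1, -1, 1] \<in> (\<lambda>x. sqrt 3 *\<^sub>R L x) ` V"
        using place[of "vector [1, 1, 1]" "vector [-1, 1, 1]" "vector [1, -1, 1]"] t 1
        by (auto simp: vec3_simps)
      have "convex hull ((\<lambda>x. sqrt 3 *\<^sub>R L x) ` V) = cube"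
        using edge_closed_set.eq_cube_vertices[OF L(2) HOL.refl HOL.refl HOL.refl L(3-5)]
        by (simp only: cube_def)
      then show ?thesis using L(1) by (intro exI[of _ L] exI[of _ 3]) simp
    next
      assume t: "t = (2 * ?g - 1) / 3"
      have "w \<bullet> u = 1/3"
        using uw(3) unfolding t by (simp add: power2_eq_square field_simps golden_ratio_square
            golden_ratio_square_left)
      moreover have rt: "3 * t = 2 * ?g - 1" using t by simp
      ultimately have "\<exists>L. orthogonal_transformation L
        \<and> edge_closed_set ((\<lambda>x. sqrt 3 *\<^sub>R L x) ` V) 3 (3 * t) k
        \<and> vector [1, 1, 1] \<in> (\<lambda>x. sqrt 3 *\<^sub>R L x) ` V
        \<and> vector [0, 1 / ?g, ?g] \<in> (\<lambda>x. sqrt 3 *\<^sub>R L x) ` V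
        \<and> vector [1 / ?g, ?g, 0] \<in> (\<lambda>x. sqrt 3 *\<^sub>R L x) ` V"
        by (intro place) (simp_all only: rt, simp_all add: vec3_simps inverse_golden_ratio
            algebra_simps golden_ratio_square golden_ratio_square_left)
      then obtain L where L: "orthogonal_transformation L"
        "edge_closed_set ((\<lambda>x. sqrt 3 *\<^sub>R L x) ` V) 3 (2 * ?g - 1) 3"
        "vector [1, 1, 1] \<in> (\<lambda>x. sqrt 3 *\<^sub>R L x) ` V"
        "vector [0, 1 / ?g, ?g] \<in> (\<lambda>x. sqrt 3 *\<^sub>R L x) ` V"
        "vector [1 / ?g, ?g, 0] \<in> (\<lambda>x. sqrt 3 *\<^sub>R L x) ` V"
        unfolding rt 1 by blast
      have "convex hull ((\<lambda>x. sqrt 3 *\<^sub>R L x) ` V) = dodecahedron"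
        using edge_closed_set.eq_dodecahedron_vertices[OF L(2) HOL.refl HOL.refl HOL.refl L(3-5)]
        by (simp only: dodecahedron_def)
      then show ?thesis using L(1) by (intro exI[of _ L] exI[of _ 3]) simp
    qed
  next
    case 2
    then have four: "card (N x) = 4" if "x \<in> V" for x using k[OF that] by simp
    obtain u w where uw: "u \<in> N v" "w \<in> N v" "w \<bullet> (v \<times> u) \<noteq> 0" "w \<bullet> u = t" and t: "t = 0 \<or> t = 1/2"
      using four_cases[OF four v] no_icosidodecahedron[OF four] by auto
    note place = place[OF uw(1-3)]
    from t show ?thesis
    proof
      assume t: "t = 0"
      obtain L where L: "orthogonal_transformation L"
        "edge_closed_set ((\<lambda>x. sqrt 1 *\<^sub>R L x) ` V) 1 0 4"
        "vector [1, 0, 0] \<in> (\<lambda>x. sqrt 1 *\<^sub>R L x) ` V"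
        "vector [0, 1, 0] \<in> (\<lambda>x. sqrt 1 *\<^sub>R L x) ` V"
        "vector [0, 0, 1] \<in> (\<lambda>x. sqrt 1 *\<^sub>R L x) ` V"
        using place[of 1 "vector [1, 0, 0]" "vector [0, 1, 0]" "vector [0, 0, 1]"] uw(4) t 2
        by (auto simp: vec3_simps)
      have "convex hull ((\<lambda>x. sqrt 1 *\<^sub>R L x) ` V) = octahedron"
        using edge_closed_set.eq_octahedron_vertices[OF L(2) HOL.refl HOL.refl HOL.refl L(3-5)]
        by (simp only: octahedron_def)
      then show ?thesis using L(1) by (intro exI[of _ L] exI[of _ 1]) simp
    next
      assume t: "t = 1/2"
      obtain L where L: "orthogonal_transformation L"
        "edge_closed_set ((\<lambda>x. sqrt 2 *\<^sub>R L x) ` V) 2 1 4"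
        "vector [1, 1, 0] \<in> (\<lambda>x. sqrt 2 *\<^sub>R L x) ` V"
        "vector [1, 0, 1] \<in> (\<lambda>x. sqrt 2 *\<^sub>R L x) ` V"
        "vector [0, 1, 1] \<in> (\<lambda>x. sqrt 2 *\<^sub>R L x) ` V"
        using place[of 2 "vector [1, 1, 0]" "vector [1, 0, 1]" "vector [0, 1, 1]"] uw(4) t 2
        by (auto simp: vec3_simps)
      have "convex hull ((\<lambda>x. sqrt 2 *\<^sub>R L x) ` V) = cuboctahedron"
        using edge_closed_set.eq_cuboctahedron_vertices[OF L(2) HOL.refl HOL.refl HOL.refl L(3-5)]
        by (simp only: cuboctahedron_eq)
      then show ?thesis using L(1) by (intro exI[of _ L] exI[of _ 2]) simp
    qed
  next
    case 3
    obtain u w where uw: "u \<in> N v" "w \<in> N v" "w \<bullet> (v \<times> u) \<noteq> 0" "w \<bullet> u = t"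
      and t: "t * (3 - ?g) = ?g - 1"
      using five_cases[OF v] k[OF v] 3 by auto
    have "((?g + 2) * t - ?g) * (3 - ?g) = (?g + 2) * (t * (3 - ?g)) - ?g * (3 - ?g)"
      by (simp add: algebra_simps)
    also have "\<dots> = 0" unfolding t by (simp add: algebra_simps golden_ratio_square golden_ratio_square_left)
    finally have rt: "(?g + 2) * t = ?g" using golden_ratio_bounds by simp
    have "0 < ?g + 2" using golden_ratio_bounds by simp
    then obtain L where L: "orthogonal_transformation L"
      "edge_closed_set ((\<lambda>x. sqrt (?g + 2) *\<^sub>R L x) ` V) (?g + 2) ?g 5"
      "vector [0, 1, ?g] \<in> (\<lambda>x. sqrt (?g + 2) *\<^sub>R L x) ` V"
      "vector [1, ?g, 0] \<in> (\<lambda>x. sqrt (?g + 2) *\<^sub>R L x) ` V"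
      "vector [?g, 0, 1] \<in> (\<lambda>x. sqrt (?g + 2) *\<^sub>R L x) ` V"
      using place[OF uw(1-3), of "?g + 2" "vector [0, 1, ?g]" "vector [1, ?g, 0]" "vector [?g, 0, 1]"]
      unfolding uw(4) rt 3 by (auto simp: vec3_simps golden_ratio_square)
    have "convex hull ((\<lambda>x. sqrt (?g + 2) *\<^sub>R L x) ` V) = icosahedron"
      using edge_closed_set.eq_icosahedron_vertices[OF L(2) HOL.refl HOL.refl HOL.refl L(3-5)]
      by (simp only: icosahedron_def)
    then show ?thesis using L(1) \<open>0 < ?g + 2\<close> by (intro exI[of _ L] exI[of _ "?g + 2"]) simp
  qed
qed

section \<open>Normalising a polyhedron\<close>

lemma point_homogeneous_pairs:
  assumes "point_homogeneous 2 M" "x \<in> M" "y \<in> M" "x' \<in> M" "y' \<in> M" "dist x y = dist x' y'"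
  shows "\<exists>f\<in>Isom M. f x = x' \<and> f y = y'"
proof -
  have "{1..2} = {1, 2 :: nat}" by auto
  then show ?thesis
    using assms(1)[unfolded point_homogeneous_def, rule_format,
        of "\<lambda>i. if i = 1 then x else y" "\<lambda>i. if i = 1 then x' else y'"] assms(2-6)
    by (auto simp: dist_commute)
qed

text \<open>The sum of the squared distances from \<open>z\<close> to the points of \<open>M\<close> is \<open>card M * (dist z b)\<^sup>2\<close> plus a
constant, and an isometry of \<open>M\<close> leaves this sum unchanged.\<close>

lemma isometry_fixes_centroid_distance:
  fixes M :: "'a::real_inner set"
  assumes fin: "finite M" and f: "f \<in> Isom M" and b: "card M *\<^sub>R b = \<Sum>M" and x: "x \<in> M"
  shows "dist (f x) b = dist x b"
proof -
  have sq: "(\<Sum>w\<in>M. (dist z w)\<^sup>2) = card M * (dist z b)\<^sup>2 + (\<Sum>w\<in>M. (dist w b)\<^sup>2)" for z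
  proof -
    have "(\<Sum>w\<in>M. (z - b) \<bullet> (w - b)) = (z - b) \<bullet> (\<Sum>M - card M *\<^sub>R b)"
      by (simp add: inner_sum_right[symmetric] sum_subtractf sum_constant_scaleR)
    then have zero: "(\<Sum>w\<in>M. (z - b) \<bullet> (w - b)) = 0" by (simp add: b)
    have "(dist z w)\<^sup>2 = (dist z b)\<^sup>2 + (dist w b)\<^sup>2 - 2 * ((z - b) \<bullet> (w - b))" for w
      by (simp add: dist_norm power2_norm_eq_inner inner_diff_left inner_diff_right inner_commute)
    then have "(\<Sum>w\<in>M. (dist z w)\<^sup>2)
        = (\<Sum>w\<in>M. (dist z b)\<^sup>2 + (dist w b)\<^sup>2 - 2 * ((z - b) \<bullet> (w - b)))"
      by (intro sum.cong refl)
    then show ?thesis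
      by (simp only: sum.distrib sum_subtractf sum_distrib_left[symmetric] zero) simp
  qed
  have bij: "bij_betw f M M" and iso: "\<And>w. w \<in> M \<Longrightarrow> dist (f x) (f w) = dist x w"
    using f x by (auto simp: Isom_def)
  have "(\<Sum>w\<in>M. (dist (f x) w)\<^sup>2) = (\<Sum>w\<in>M. (dist (f x) (f w))\<^sup>2)"
    by (rule sum.reindex_bij_betw[OF bij, symmetric])
  also have "\<dots> = (\<Sum>w\<in>M. (dist x w)\<^sup>2)" by (simp add: iso)
  finally have "card M * (dist (f x) b)\<^sup>2 = card M * (dist x b)\<^sup>2" by (simp add: sq)
  moreover have "card M \<noteq> 0" using x fin by auto
  ultimately have "(dist (f x) b)\<^sup>2 = (dist x b)\<^sup>2" by simp
  then show ?thesis by (simp add: power2_eq_iff_nonneg)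
qed

lemma exposed_pair_homothety:
  assumes R: "0 < R" and ex: "exposed_pair ((\<lambda>x. (1 / R) *\<^sub>R (x - b)) ` S) ((1 / R) *\<^sub>R (p - b)) ((1 / R) *\<^sub>R (q - b))"
    and pq: "p \<in> S" "q \<in> S"
  shows "exposed_pair S p q"
proof -
  let ?g = "\<lambda>x. (1 / R) *\<^sub>R (x - b)"
  obtain h c where h: "h \<bullet> ?g p = c" "h \<bullet> ?g q = c" "?g p \<noteq> ?g q"
    and lt: "\<forall>y\<in>?g ` S - {?g p, ?g q}. h \<bullet> y < c"
    using ex unfolding exposed_pair_def by blast
  have hx: "h \<bullet> x = R * (h \<bullet> ?g x) + h \<bullet> b" for x using R by (simp add: inner_diff_right)
  have "h \<bullet> x < R * c + h \<bullet> b" if "x \<in> S - {p, q}" for x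
  proof -
    have "?g x \<in> ?g ` S - {?g p, ?g q}" using that R by auto
    then have "h \<bullet> ?g x < c" using lt by blast
    then have "R * (h \<bullet> ?g x) < R * c" by (rule mult_strict_left_mono[OF _ R])
    then show ?thesis unfolding hx[of x] by linarith
  qed
  then show ?thesis
    unfolding exposed_pair_def using pq h
    by (intro conjI exI[of _ h] exI[of _ "R * c + h \<bullet> b"]) (auto simp: hx[of p] hx[of q])
qed

text \<open>The largest inner product \<open>t\<close> of two distinct points is attained on an exposed pair; all exposed
pairs come from edges of \<open>P\<close>, so they have the same inner product \<open>t\<close>.\<close>

lemma vertices_normalised:
  fixes P :: "(real^3) set"
  assumes poly: "polytope P" and dim: "aff_dim P = 3"
    and hom: "point_homogeneous 2 (vertices P)" and edges: "equal_edge_lengths P"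
  shows "\<exists>b R t. 0 < R \<and> homogeneous_sphere_set ((\<lambda>x. (1 / R) *\<^sub>R (x - b)) ` vertices P) t"
proof -
  define S where "S = vertices P"
  have P: "P = convex hull S"
    using Krein_Milman_Minkowski[OF polytope_imp_compact[OF poly] polytope_imp_convex[OF poly]]
    by (simp add: S_def vertices_def)
  have finS: "finite S"
    using finite_polyhedron_extreme_points[OF polytope_imp_polyhedron[OF poly]]
    by (simp add: S_def vertices_def)
  have plane: "G = 0" if "\<And>x. x \<in> S \<Longrightarrow> G \<bullet> x = c" for G c
  proof (rule ccontr)
    assume "G \<noteq> 0"
    have "P \<subseteq> {x. G \<bullet> x = c}"
      unfolding P by (rule hull_minimal) (use that convex_hyperplane in auto)
    then have "aff_dim P \<le> aff_dim {x. G \<bullet> x = c}" by (rule aff_dim_subset)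
    then show False using \<open>G \<noteq> 0\<close> dim by simp
  qed
  define b where "b = (1 / card S) *\<^sub>R \<Sum>S"
  have "axis 1 1 \<noteq> (0 :: real^3)" by (simp add: axis_eq_0_iff)
  then have "S \<noteq> {}" using plane[of "axis 1 1" 0] by auto
  then obtain s where s: "s \<in> S" by auto
  have b: "card S *\<^sub>R b = \<Sum>S" using finS s by (auto simp: b_def)
  define R where "R = dist s b"
  have R: "dist x b = R" if "x \<in> S" for x
  proof -
    have "\<exists>f\<in>Isom S. f x = s \<and> f x = s"
      using point_homogeneous_pairs[of S x x s s] hom that s by (simp add: S_def)
    then show ?thesis using isometry_fixes_centroid_distance[OF finS _ b that] by (auto simp: R_def)
  qed
  have "R \<noteq> 0"
  proof
    assume "R = 0"
    then have "x = b" if "x \<in> S" for x using R[OF that] by simp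
    then have "axis 1 1 = (0 :: real^3)" by (intro plane[of _ "axis 1 1 \<bullet> b"]) auto
    then show False using \<open>axis 1 1 \<noteq> 0\<close> by simp
  qed
  then have R0: "0 < R" using zero_le_dist[of s b] by (simp add: R_def)
  define g where "g x = (1 / R) *\<^sub>R (x - b)" for x
  have unit: "g x \<bullet> g x = 1" if "x \<in> S" for x
  proof -
    have "(x - b) \<bullet> (x - b) = R\<^sup>2"
      using R[OF that] by (simp add: dist_norm power2_norm_eq_inner[symmetric])
    then show ?thesis using R0 by (simp add: g_def power2_eq_square)
  qed
  have ip: "g x \<bullet> g y = 1 - (dist x y)\<^sup>2 / (2 * R\<^sup>2)" if "x \<in> S" "y \<in> S" for x y
  proof -
    have "g x - g y = (1 / R) *\<^sub>R (x - y)" by (simp add: g_def scaleR_diff_right[symmetric])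
    then have "(g x - g y) \<bullet> (g x - g y) = (dist x y)\<^sup>2 / R\<^sup>2"
      by (simp add: dist_norm power2_norm_eq_inner) (simp add: power2_eq_square)
    then have "2 - 2 * (g x \<bullet> g y) = (dist x y)\<^sup>2 / R\<^sup>2"
      using unit[OF that(1)] unit[OF that(2)] by (simp add: inner_diff_left inner_diff_right inner_commute)
    then show ?thesis by (simp add: field_simps)
  qed
  have full: "G = 0" if G: "\<And>x. x \<in> g ` S \<Longrightarrow> G \<bullet> x = c" for G c
  proof (rule plane)
    fix x assume "x \<in> S"
    then have "G \<bullet> g x = c" using G by simp
    then show "G \<bullet> x = R * c + G \<bullet> b" using R0 by (simp add: g_def inner_diff_right field_simps)
  qed
  have span: "span (g ` S) = UNIV"
    using full[of _ 0] by (intro span_UNIV_if_no_normal) blast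
  have edge: "g x \<bullet> g y = g x' \<bullet> g y'"
    if "exposed_pair (g ` S) (g x) (g y)" "exposed_pair (g ` S) (g x') (g y')"
      "x \<in> S" "y \<in> S" "x' \<in> S" "y' \<in> S" for x y x' y'
  proof -
    have "exposed_pair S x y" "exposed_pair S x' y'"
      using exposed_pair_homothety[OF R0, of b S] that unfolding g_def by blast+
    then have "closed_segment x y edge_of P" "closed_segment x' y' edge_of P"
      unfolding P using exposed_pair_edge_of[OF finS] by blast+
    then have "dist x y = dist x' y'" using edges unfolding equal_edge_lengths_def by blast
    then show ?thesis using ip that by simp
  qed
  define T where "T = {g x \<bullet> g y | x y. x \<in> S \<and> y \<in> S \<and> g x \<noteq> g y}"
  define t where "t = Max T"
  have "T \<subseteq> (\<lambda>(x, y). g x \<bullet> g y) ` (Sigma S (\<lambda>_. S))" by (auto simp: T_def)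
  then have finT: "finite T" using finS by (meson finite_SigmaI finite_imageI finite_subset)
  have "T \<noteq> {}"
  proof
    assume "T = {}"
    then have "g y = g s" if "y \<in> S" for y using that s unfolding T_def by blast
    then have "g s = 0" using unit[OF s] by (intro full[of _ 1]) auto
    then show False using unit[OF s] by simp
  qed
  then have "t \<in> T" using finT by (simp add: t_def)
  then obtain p q where pq: "p \<in> S" "q \<in> S" "g p \<noteq> g q" "t = g p \<bullet> g q" by (auto simp: T_def)
  have sep: "x \<bullet> y \<le> t" if "x \<in> g ` S" "y \<in> g ` S" "x \<noteq> y" for x y
    unfolding t_def by (rule Max_ge[OF finT]) (use that in \<open>auto simp: T_def\<close>)
  have "0 < (g p - g q) \<bullet> (g p - g q)" using pq by simp
  then have t1: "t < 1" using unit pq by (simp add: inner_diff_left inner_diff_right inner_commute)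
  have closest: "exposed_pair (g ` S) (g p) (g q)"
    unfolding exposed_pair_def
  proof (intro conjI exI[of _ "g p + g q"] exI[of _ "1 + t"] ballI)
    fix x assume "x \<in> g ` S - {g p, g q}"
    then have "g p \<bullet> x \<le> t" "g q \<bullet> x \<le> t" using sep pq by auto
    then show "(g p + g q) \<bullet> x < 1 + t" using t1 by (simp add: inner_add_left)
  qed (use pq unit in \<open>auto simp: inner_add_left inner_add_right inner_commute\<close>)
  have "homogeneous_sphere_set (g ` S) t"
  proof
    show "finite (g ` S)" using finS by simp
    show "t < 1" by (rule t1)
    show "x \<bullet> x = 1" if "x \<in> g ` S" for x using that unit by auto
    show "x \<bullet> y \<le> t" if "x \<in> g ` S" "y \<in> g ` S" "x \<noteq> y" for x y using sep that .
    show "G = 0" if "\<And>x. x \<in> g ` S \<Longrightarrow> G \<bullet> x = c" for G c using full that .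
  next
    fix v G x
    assume v: "v \<in> g ` S" and x: "x \<in> g ` S"
      and loc: "\<And>u. u \<in> g ` S \<Longrightarrow> u \<bullet> v = t \<Longrightarrow> G \<bullet> u \<le> G \<bullet> v"
    show "G \<bullet> x \<le> G \<bullet> v"
    proof (rule ccontr)
      assume "\<not> ?thesis"
      then have "\<exists>u. exposed_pair (g ` S) v u \<and> G \<bullet> v < G \<bullet> u"
        using finS unit v x by (intro improving_edge[where z = x]) auto
      then obtain u where u: "exposed_pair (g ` S) v u" "G \<bullet> v < G \<bullet> u" by auto
      then have uS: "u \<in> g ` S" by (simp add: exposed_pair_def)
      have "v \<bullet> u = t" using edge[OF _ closest _ _ pq(1,2)] u(1) v uS pq(4) by auto
      then show False using loc[OF uS] u(2) by (simp add: inner_commute)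
    qed
  next
    fix x y x' y'
    assume "x \<in> g ` S" "y \<in> g ` S" "x' \<in> g ` S" "y' \<in> g ` S" and eq: "x \<bullet> y = x' \<bullet> y'"
    then obtain x0 y0 x1 y1 where *: "x0 \<in> S" "y0 \<in> S" "x1 \<in> S" "y1 \<in> S"
      "x = g x0" "y = g y0" "x' = g x1" "y' = g y1" by auto
    have "(dist x0 y0)\<^sup>2 = (dist x1 y1)\<^sup>2" using eq ip R0 by (simp add: *)
    then have "dist x0 y0 = dist x1 y1" by (simp add: power2_eq_iff_nonneg)
    then have "\<exists>f\<in>Isom S. f x0 = x1 \<and> f y0 = y1"
      using point_homogeneous_pairs[of S x0 y0 x1 y1] hom * by (simp add: S_def)
    then obtain f where f: "f \<in> Isom S" "f x0 = x1" "f y0 = y1" by auto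
    have fS: "f ` S = S" and iso: "\<And>x y. x \<in> S \<Longrightarrow> y \<in> S \<Longrightarrow> dist (f x) (f y) = dist x y"
      using f(1) by (auto simp: Isom_def bij_betw_def)
    have "\<exists>F. orthogonal_transformation F \<and> (\<forall>i\<in>S. F (g i) = g (f i))"
    proof (rule isometric_extension[OF finS span])
      fix i j assume "i \<in> S" "j \<in> S"
      moreover have "f i \<in> S" "f j \<in> S" using fS calculation by auto
      ultimately show "g i \<bullet> g j = g (f i) \<bullet> g (f j)" by (simp add: ip iso)
    qed
    then obtain F where F: "orthogonal_transformation F" "\<And>i. i \<in> S \<Longrightarrow> F (g i) = g (f i)" by auto
    have "F ` g ` S = g ` f ` S" using F(2) by (auto simp: image_image)
    then have "F ` g ` S = g ` S" by (simp add: fS)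
    then show "\<exists>F. orthogonal_transformation F \<and> F ` g ` S = g ` S \<and> F x = x' \<and> F y = y'"
      using F f * by (intro exI[of _ F]) simp
  qed
  then show ?thesis using R0 unfolding g_def[abs_def] S_def by blast
qed

lemma similar_convex_hull:
  fixes S T :: "'a::euclidean_space set"
  assumes L: "orthogonal_transformation L" and r: "0 < r"
  shows "similar (convex hull S) (convex hull ((\<lambda>x. r *\<^sub>R L (x - b)) ` S))"
proof -
  let ?f = "\<lambda>x. r *\<^sub>R L (x - b)"
  have f: "?f x = - (r *\<^sub>R L b) + r *\<^sub>R L x" for x
    by (simp add: orthogonal_transformation_diff[OF L] scaleR_diff_right)
  have lin: "linear (\<lambda>x. r *\<^sub>R L x)"
    using L by (intro linear_compose_scale_right orthogonal_transformation_linear)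
  have hull: "?f ` (convex hull S) = convex hull (?f ` S)"
  proof -
    have "?f ` A = (+) (- (r *\<^sub>R L b)) ` (\<lambda>x. r *\<^sub>R L x) ` A" for A
      unfolding image_image f ..
    then show ?thesis
      by (simp only: convex_hull_translation convex_hull_linear_image[OF lin])
  qed
  have "bij ?f"
  proof (rule bijI)
    show "inj ?f" using r by (auto intro!: injI simp: inj_eq[OF orthogonal_transformation_inj[OF L]])
    show "surj ?f"
    proof (rule surjI)
      fix y
      have "L (inv L ((1 / r) *\<^sub>R y)) = (1 / r) *\<^sub>R y"
        using orthogonal_transformation_surj[OF L] by (simp add: surj_f_inv_f)
      then show "?f (inv L ((1 / r) *\<^sub>R y) + b) = y" using r by simp
    qed
  qed
  moreover have "dist (?f x) (?f y) = r * dist x y" for x y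
  proof -
    have "?f x - ?f y = r *\<^sub>R L (x - y)" by (simp add: f orthogonal_transformation_diff[OF L] scaleR_diff_right)
    then show ?thesis using r L by (simp add: dist_norm orthogonal_transformation_norm)
  qed
  ultimately show ?thesis
    unfolding similar_def using r hull by (intro exI[of _ ?f] exI[of _ r]) blast
qed

theorem theorem2:
  fixes P :: "(real^3) set"
  assumes "polytope P" and "aff_dim P = 3"
    and "point_homogeneous_polytope 2 P"
    and "equal_edge_lengths P"
  shows "similar P cuboctahedron \<or> regular_polyhedron P"
proof -
  have "point_homogeneous 2 (vertices P)"
    using assms(3) by (simp add: point_homogeneous_polytope_def)
  then obtain b R t where R: "0 < R"
    and V: "homogeneous_sphere_set ((\<lambda>x. (1 / R) *\<^sub>R (x - b)) ` vertices P) t"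
    using vertices_normalised assms by blast
  obtain L r where L: "orthogonal_transformation L" and r: "0 < r"
    and Q: "convex hull ((\<lambda>x. sqrt r *\<^sub>R L x) ` (\<lambda>x. (1 / R) *\<^sub>R (x - b)) ` vertices P)
      \<in> {tetrahedron, cube, octahedron, dodecahedron, icosahedron, cuboctahedron}"
    using homogeneous_sphere_set.hull_is_listed_polyhedron[OF V] by blast
  have P: "P = convex hull (vertices P)"
    using Krein_Milman_Minkowski[OF polytope_imp_compact[OF assms(1)] polytope_imp_convex[OF assms(1)]]
    by (simp add: vertices_def)
  have "(\<lambda>x. sqrt r *\<^sub>R L x) ` (\<lambda>x. (1 / R) *\<^sub>R (x - b)) ` vertices P
      = (\<lambda>x. (sqrt r / R) *\<^sub>R L (x - b)) ` vertices P"
    by (simp add: image_image orthogonal_transformation_scaleR[OF L])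
  moreover have "similar P (convex hull ((\<lambda>x. (sqrt r / R) *\<^sub>R L (x - b)) ` vertices P))"
    using similar_convex_hull[OF L, of "sqrt r / R" "vertices P" b] R r P by simp
  ultimately show ?thesis using Q by (auto simp: regular_polyhedron_def)
qed

end
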